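(* Let $\Bbbk$ be an algebraically closed field of characteristic $p>0$, let $G$ be a closed subgroup of $\operatorname{GL}_2(\Bbbk)$ containing an infinite unipotent subgroup, and let $V$ denote the restriction to $G$ of the natural $2$-dimensional $\operatorname{GL}_2(\Bbbk)$-module. For any integer $n\ge 0$ set $V_n:=\operatorname{Hom}_{\Bbbk}(S^{p^n-1}(V),S^{p^n-1}(V))$. Then $\delta(G,V_n)\ge p^n$.
   Context: $\operatorname{Hom}_\Bbbk(W,W)$ carries the usual conjugation action of $G$ for a $G$-module $W$. For a $G$-module (finite-dimensional rational representation) $W$, $\Bbbk[W]\cong S(W^* )$ is the ring of polynomial functions on $W$, with $G$-action $(g\cdot f)(w)=f(g^{-1}w)$ and invariant ring $\Bbbk[W]^G$, graded by degree. $\Bbbk[W]^G_{\le d}$ is the set of invariants of degree at most $d$. For $S\subseteq \Bbbk[W]$, $S_+$ is the set of elements of $S$ with constant term zero. The nullcone $\mathcal{N}_{G,W}\subseteq W$ is the common zero set of $\Bbbk[W]^G_+$. A subset $S\subseteq\Bbbk[W]^G$ is a $\delta$-set if for every $w\in W^G\setminus\mathcal{N}_{G,W}$ there is $f\in S_+$ with $f(w)\neq 0$. Define $\delta(G,W)=\min\{d\ge 0 : \Bbbk[W]^G_{\le d}\text{ is a }\delta\text{-set}\}$. *)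

theory Defs
  imports
    "HOL-Analysis.Determinants"
    "HOL-Computational_Algebra.Polynomial"
    "HOL-Algebra.Group"
    "HOL-Library.Poly_Mapping"
    "HOL-Library.Function_Algebras"
    "HOL-Library.Extended_Nat"
    "HOL-Library.Numeral_Type"
begin

section \<open>Representations\<close>

text \<open>
  A representation of a group with elements of type \<open>'g\<close> on a vector space over \<open>'k\<close>. The space is
  the subset \<open>vecs\<close> of the additive group \<open>'w\<close>, so that its dimension may depend on a natural number.
  No axioms are bundled into the record.
\<close>

record ('g, 'k, 'w) rep =
  vecs :: "'w set"
  scl :: "'k \<Rightarrow> 'w \<Rightarrow> 'w"
  act :: "'g \<Rightarrow> 'w \<Rightarrow> 'w"

definition linear_on ::
  "('g, 'k, 'a::ab_group_add) rep \<Rightarrow> ('k \<Rightarrow> 'b \<Rightarrow> 'b) \<Rightarrow> ('a \<Rightarrow> 'b::ab_group_add) \<Rightarrow> bool" where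
  "linear_on M s T \<longleftrightarrow>
     (\<forall>x \<in> vecs M. \<forall>y \<in> vecs M. T (x + y) = T x + T y) \<and>
     (\<forall>c. \<forall>x \<in> vecs M. T (scl M c x) = s c (T x))"

text \<open>
  \<open>Hom\<^sub>k(M, N)\<close>, with the action \<open>(g \<cdot> T)(x) = g T(g\<^sup>-\<^sup>1 x)\<close>. A linear map \<open>M \<rightarrow> N\<close> is encoded as a
  function vanishing off \<open>vecs M\<close>, so that equality of functions is equality of linear maps.
\<close>

definition Hom_rep ::
  "('g, 'c) monoid_scheme \<Rightarrow> ('g, 'k, 'a::ab_group_add) rep \<Rightarrow> ('g, 'k, 'b::ab_group_add) rep
     \<Rightarrow> ('g, 'k, 'a \<Rightarrow> 'b) rep" where
  "Hom_rep G M N =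
     \<lparr> vecs = {T. linear_on M (scl N) T \<and> (\<forall>x \<in> vecs M. T x \<in> vecs N) \<and> (\<forall>x. x \<notin> vecs M \<longrightarrow> T x = 0)},
       scl = (\<lambda>c T x. scl N c (T x)),
       act = (\<lambda>g T x. if x \<in> vecs M then act N g (T (act M (inv\<^bsub>G\<^esub> g) x)) else 0) \<rparr>"

section \<open>Polynomial functions, invariants and delta\<close>

text \<open>
  \<open>poly_fun W d f\<close>: on \<open>vecs W\<close>, the function \<open>f\<close> is a polynomial of degree at most \<open>d\<close> in elements
  of the dual space. Only the values on \<open>vecs W\<close> matter. Over an infinite field, such as an
  algebraically closed one, polynomial functions are the same as elements of \<open>S(W\<^sup>*)\<close>, and
  the degrees agree.
\<close>

inductive poly_fun ::
  "('g, 'k::field, 'w::ab_group_add) rep \<Rightarrow> nat \<Rightarrow> ('w \<Rightarrow> 'k) \<Rightarrow> bool"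
  for W where
  const: "poly_fun W d (\<lambda>_. c)"
| linear: "linear_on W (*) \<phi> \<Longrightarrow> 1 \<le> d \<Longrightarrow> poly_fun W d \<phi>"
| add: "poly_fun W d f \<Longrightarrow> poly_fun W d h \<Longrightarrow> poly_fun W d (\<lambda>w. f w + h w)"
| mult: "poly_fun W d f \<Longrightarrow> poly_fun W e h \<Longrightarrow> poly_fun W (d + e) (\<lambda>w. f w * h w)"

definition coordinate_ring :: "('g, 'k::field, 'w::ab_group_add) rep \<Rightarrow> ('w \<Rightarrow> 'k) set" where
  "coordinate_ring W = {f. \<exists>d. poly_fun W d f}"

definition invariants ::
  "('g, 'c) monoid_scheme \<Rightarrow> ('g, 'k::field, 'w::ab_group_add) rep \<Rightarrow> ('w \<Rightarrow> 'k) set" where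
  "invariants G W =
     {f \<in> coordinate_ring W. \<forall>g \<in> carrier G. \<forall>w \<in> vecs W. f (act W (inv\<^bsub>G\<^esub> g) w) = f w}"

definition invariants_le ::
  "('g, 'c) monoid_scheme \<Rightarrow> ('g, 'k::field, 'w::ab_group_add) rep \<Rightarrow> nat \<Rightarrow> ('w \<Rightarrow> 'k) set" where
  "invariants_le G W d = {f \<in> invariants G W. poly_fun W d f}"

text \<open>The constant term of a polynomial function is its value at the origin.\<close>

definition positive_part :: "('w::zero \<Rightarrow> 'k::zero) set \<Rightarrow> ('w \<Rightarrow> 'k) set" where
  "positive_part S = {f \<in> S. f 0 = 0}"

definition nullcone ::
  "('g, 'c) monoid_scheme \<Rightarrow> ('g, 'k::field, 'w::ab_group_add) rep \<Rightarrow> 'w set" where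
  "nullcone G W = {w \<in> vecs W. \<forall>f \<in> positive_part (invariants G W). f w = 0}"

definition fixed_points ::
  "('g, 'c) monoid_scheme \<Rightarrow> ('g, 'k, 'w) rep \<Rightarrow> 'w set" where
  "fixed_points G W = {w \<in> vecs W. \<forall>g \<in> carrier G. act W g w = w}"

definition delta_set ::
  "('g, 'c) monoid_scheme \<Rightarrow> ('g, 'k::field, 'w::ab_group_add) rep \<Rightarrow> ('w \<Rightarrow> 'k) set \<Rightarrow> bool" where
  "delta_set G W S \<longleftrightarrow>
     S \<subseteq> invariants G W \<and>
     (\<forall>w \<in> fixed_points G W - nullcone G W. \<exists>f \<in> positive_part S. f w \<noteq> 0)"

text \<open>
  For finite-dimensional \<open>W\<close> the set below is nonempty (the ideal generated by the invariants
  without constant term is finitely generated), and the infimum in \<open>enat\<close> of a nonempty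
  set of natural numbers is its minimum.
\<close>

definition delta ::
  "('g, 'c) monoid_scheme \<Rightarrow> ('g, 'k::field, 'w::ab_group_add) rep \<Rightarrow> enat" where
  "delta G W = Inf {enat d | d. delta_set G W (invariants_le G W d)}"

section \<open>Linear groups and the natural module\<close>

definition GL :: "('k::field^'n^'n) monoid" where
  "GL = \<lparr> carrier = {A. invertible A}, mult = (**), one = mat 1 \<rparr>"

definition natural_rep :: "('k::field^'n^'n, 'k, 'k^'n) rep" where
  "natural_rep = \<lparr> vecs = UNIV, scl = (*s), act = (*v) \<rparr>"

text \<open>
  All square matrices as a vector space; the action (left multiplication) plays no role for
  its polynomial functions.
\<close>

definition matrix_rep :: "('k::field^'n^'n, 'k, 'k^'n^'n) rep" where
  "matrix_rep = \<lparr> vecs = UNIV, scl = (\<lambda>c A. \<chi> i. c *s (A $ i)), act = (**) \<rparr>"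

text \<open>
  Zariski closedness in \<open>GL\<close>. The regular functions on \<open>GL\<close> are polynomials in the entries divided by
  powers of the determinant, so polynomials in the entries define the same closed sets.
\<close>

definition closed_in_GL :: "('k::field^'n^'n) set \<Rightarrow> bool" where
  "closed_in_GL X \<longleftrightarrow>
     (\<exists>F \<subseteq> coordinate_ring (matrix_rep :: ('k^'n^'n, 'k, 'k^'n^'n) rep).
        X = {A \<in> carrier GL. \<forall>f \<in> F. f A = 0})"

definition unipotent :: "'k::field^'n^'n \<Rightarrow> bool" where
  "unipotent A \<longleftrightarrow> (\<exists>N. (((**) (A - mat 1)) ^^ N) (mat 1) = 0)"

section \<open>Symmetric powers\<close>

text \<open>
  The symmetric algebra of \<open>k\<^sup>n\<close> is the polynomial ring in the standard basis vectors. A monomial is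
  an exponent function \<open>'n \<Rightarrow>\<^sub>0 nat\<close>; \<open>sym_of\<close> is the inclusion of \<open>k\<^sup>n\<close> as the linear forms.
\<close>

type_synonym ('k, 'n) sym = "('n \<Rightarrow>\<^sub>0 nat) \<Rightarrow>\<^sub>0 'k"

definition sym_of :: "'k::field^'n \<Rightarrow> ('k, 'n) sym" where
  "sym_of v = (\<Sum>i\<in>UNIV. Poly_Mapping.single (Poly_Mapping.single i 1) (v $ i))"

definition sym_scale :: "'k::field \<Rightarrow> ('k, 'n) sym \<Rightarrow> ('k, 'n) sym" where
  "sym_scale c f = Poly_Mapping.single 0 c * f"

text \<open>The algebra endomorphism of the symmetric algebra extending a linear map \<open>T\<close> of \<open>k\<^sup>n\<close>.\<close>

definition sym_map :: "('k::field^'n \<Rightarrow> 'k^'n) \<Rightarrow> ('k, 'n) sym \<Rightarrow> ('k, 'n) sym" where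
  "sym_map T f =
     (\<Sum>m \<in> Poly_Mapping.keys f. sym_scale (Poly_Mapping.lookup f m)
        (\<Prod>i\<in>UNIV. sym_of (T (axis i 1)) ^ Poly_Mapping.lookup m i))"

text \<open>\<open>S\<^sup>r(V)\<close> for a representation \<open>V\<close> whose underlying space is all of \<open>k\<^sup>n\<close>.\<close>

definition Sym_rep :: "nat \<Rightarrow> ('g, 'k::field, 'k^'n) rep \<Rightarrow> ('g, 'k, ('k, 'n) sym) rep" where
  "Sym_rep r V =
     \<lparr> vecs = {f. \<forall>m \<in> Poly_Mapping.keys f. (\<Sum>i\<in>UNIV. Poly_Mapping.lookup m i) = r},
       scl = sym_scale,
       act = (\<lambda>g. sym_map (act V g)) \<rparr>"

end

theory Submission
  imports "Jordan_Normal_Form.Determinant" Defs "HOL-Number_Theory.Cong"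
begin

text \<open>
  Put \<open>q = p\<^sup>n\<close> and \<open>S = S\<^bsup>q-1\<^esup>(V)\<close>. The identity of \<open>S\<close> is a fixed point, and the determinant is an
  invariant without constant term that does not vanish there; so it suffices that every
  invariant \<open>f\<close> of degree less than \<open>q\<close> satisfies \<open>f(id) = f(0)\<close>.

  An infinite unipotent subgroup of \<open>GL\<^sub>2\<close> consists of shears \<open>1 + tN\<close> with \<open>N\<^sup>2 = 0\<close>, and the occurring \<open>t\<close>
  form an infinite subgroup of \<open>(k,+)\<close>, which contains a subgroup \<open>E\<close> of order \<open>q\<close>. If \<open>Nv \<noteq> 0\<close>, the
  powers \<open>(v + cNv)\<^bsup>q-1\<^esup>\<close>, \<open>c \<in> E\<close>, form a basis of \<open>S\<close> (no binomial coefficient of order \<open>q - 1\<close> vanishes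
  in \<open>k\<close>), which \<open>E\<close> permutes simply transitively. Hence \<open>id\<close> is the sum of the projections \<open>\<phi>\<^sub>c\<close> onto the
  basis lines, and \<open>E\<close> permutes these as well.

  Let \<open>F(A) = f(\<Sum>c\<in>A. \<phi>\<^sub>c)\<close> for \<open>A \<subseteq> E\<close>. As \<open>f\<close> has degree less than \<open>|E|\<close>, the \<open>|E|\<close>-fold finite difference
  \<open>\<Sum>A\<subseteq>E. (-1)\<^bsup>|A|\<^esup> (F(A) - F({}))\<close> vanishes. On the other hand \<open>F\<close> is invariant under translation by the
  \<open>p\<close>-group \<open>E\<close>, so modulo \<open>p\<close> only the fixed subsets \<open>{}\<close> and \<open>E\<close> contribute, which gives \<open>F(E) = F({})\<close>.
\<close>

hide_const (open) Matrix.mat Determinant.det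
no_notation Matrix.vec_index (infixl "$" 100)

section \<open>The symmetric algebra\<close>

lemma sym_scale_single: "sym_scale c (Poly_Mapping.single m d) = Poly_Mapping.single m (c * d)"
  by (simp add: sym_scale_def mult_single)

lemma lookup_sym_scale: "Poly_Mapping.lookup (sym_scale c f) m = c * Poly_Mapping.lookup f m"
  by (simp add: sym_scale_def map.rep_eq when_def flip: mult_map_scale_conv_mult)

lemma vector_space_sym_scale: "vector_space (sym_scale :: 'k::field \<Rightarrow> ('k, 'n) sym \<Rightarrow> _)"
  by unfold_locales
    (auto intro!: poly_mapping_eqI simp: lookup_sym_scale lookup_add algebra_simps)

interpretation sym: vector_space "sym_scale :: 'k::field \<Rightarrow> ('k, 'n) sym \<Rightarrow> _"
  by (rule vector_space_sym_scale)

lemma sym_scale_mult_left: "sym_scale c f * g = sym_scale c (f * g)"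
  by (simp add: sym_scale_def mult.assoc)

lemma sym_scale_mult_right: "f * sym_scale c g = sym_scale c (f * g)"
  by (simp add: sym_scale_def mult_ac)

lemma sum_single_lookup: 
  assumes "finite K" "Poly_Mapping.keys f \<subseteq> K"
  shows "f = (\<Sum>m\<in>K. Poly_Mapping.single m (Poly_Mapping.lookup f m))"
proof (rule poly_mapping_eqI)
  fix m
  show "Poly_Mapping.lookup f m =
      Poly_Mapping.lookup (\<Sum>m\<in>K. Poly_Mapping.single m (Poly_Mapping.lookup f m)) m"
    using assms by (auto simp: lookup_sum lookup_single when_def in_keys_iff subset_iff)
qed

lemma sym_map_superset:
  assumes "finite K" "Poly_Mapping.keys f \<subseteq> K"
  shows "sym_map T f = (\<Sum>m\<in>K. sym_scale (Poly_Mapping.lookup f m)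
        (\<Prod>i\<in>UNIV. sym_of (T (axis i 1)) ^ Poly_Mapping.lookup m i))"
  unfolding sym_map_def using assms
  by (intro sum.mono_neutral_left) (auto simp: in_keys_iff)

lemma sym_map_single:
  "sym_map T (Poly_Mapping.single m c) =
     sym_scale c (\<Prod>i\<in>UNIV. sym_of (T (axis i 1)) ^ Poly_Mapping.lookup m i)"
  by (subst sym_map_superset[of "{m}"]) auto

lemma sym_map_zero [simp]: "sym_map T 0 = 0"
  by (simp add: sym_map_def)

lemma sym_map_add: "sym_map T (f + g) = sym_map T f + sym_map T g"
proof -
  let ?K = "Poly_Mapping.keys f \<union> Poly_Mapping.keys g"
  have "finite ?K" "Poly_Mapping.keys (f + g) \<subseteq> ?K"
    by (auto simp: Poly_Mapping.keys_add)
  then show ?thesis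
    by (simp add: sym_map_superset[of ?K] lookup_add sym.scale_left_distrib sum.distrib)
qed

lemma sym_map_sum: "sym_map T (\<Sum>a\<in>A. f a) = (\<Sum>a\<in>A. sym_map T (f a))"
  by (induction A rule: infinite_finite_induct) (auto simp: sym_map_add)

lemma sym_map_single_mult:
  "sym_map T (Poly_Mapping.single m c * Poly_Mapping.single m' c') =
     sym_map T (Poly_Mapping.single m c) * sym_map T (Poly_Mapping.single m' c')"
  by (simp add: mult_single sym_map_single lookup_add power_add prod.distrib
      sym_scale_mult_left sym_scale_mult_right)

lemma sym_map_mult: "sym_map T (f * g) = sym_map T f * sym_map T g"
proof -
  let ?s = "\<lambda>f m. Poly_Mapping.single m (Poly_Mapping.lookup f m)"
  have *: "h = (\<Sum>m\<in>Poly_Mapping.keys h. ?s h m)" for h :: "('k::field, 'n) sym"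
    by (rule sum_single_lookup) auto
  have "sym_map T (f * g) =
      sym_map T ((\<Sum>m\<in>Poly_Mapping.keys f. ?s f m) * (\<Sum>m\<in>Poly_Mapping.keys g. ?s g m))"
    using *[of f] *[of g] by simp
  also have "\<dots> = sym_map T (\<Sum>m\<in>Poly_Mapping.keys f. ?s f m) * sym_map T (\<Sum>m\<in>Poly_Mapping.keys g. ?s g m)"
    unfolding sum_product sym_map_sum sym_map_single_mult ..
  also have "\<dots> = sym_map T f * sym_map T g"
    using *[of f] *[of g] by simp
  finally show ?thesis .
qed

lemma sym_map_scale: "sym_map T (sym_scale c f) = sym_scale c (sym_map T f)"
  unfolding sym_scale_def sym_map_mult by (simp add: sym_map_single sym_scale_def)

lemma sym_map_one [simp]: "sym_map T 1 = 1"
  using sym_map_single[of T 0 1] by simp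

lemma sym_map_power: "sym_map T (f ^ n) = sym_map T f ^ n"
  by (induction n) (auto simp: sym_map_mult)

lemma sym_map_prod: "sym_map T (\<Prod>a\<in>A. f a) = (\<Prod>a\<in>A. sym_map T (f a))"
  by (induction A rule: infinite_finite_induct) (auto simp: sym_map_mult)

lemma sym_of_add: "sym_of (v + w) = sym_of v + sym_of w"
  by (simp add: sym_of_def single_add sum.distrib)

lemma sym_of_scale: "sym_of (c *s v) = sym_scale c (sym_of v)"
  by (simp add: sym_of_def sym_scale_single sym.scale_sum_right)

lemma sym_of_zero [simp]: "sym_of 0 = 0"
  by (simp add: sym_of_def)

lemma sym_of_sum: "sym_of (\<Sum>a\<in>A. f a) = (\<Sum>a\<in>A. sym_of (f a))"
  by (induction A rule: infinite_finite_induct) (auto simp: sym_of_add)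

lemma sym_of_axis: "sym_of (axis i 1) = Poly_Mapping.single (Poly_Mapping.single i 1) 1"
proof -
  have "sym_of (axis i 1) = (\<Sum>j\<in>UNIV. if j = i then Poly_Mapping.single (Poly_Mapping.single i 1) 1 else 0)"
    unfolding sym_of_def by (intro sum.cong) (auto simp: axis_def)
  then show ?thesis by simp
qed

lemma sym_map_sym_of:
  fixes M :: "'k::field^'n^'n"
  shows "sym_map ((*v) M) (sym_of w) = sym_of (M *v w)"
proof -
  have 1: "(\<Prod>j\<in>UNIV. F j ^ Poly_Mapping.lookup (Poly_Mapping.single i 1) j) = F i"
    for F :: "'n \<Rightarrow> ('k, 'n) sym" and i
  proof -
    have "(\<Prod>j\<in>UNIV. F j ^ Poly_Mapping.lookup (Poly_Mapping.single i 1) j) =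
        (\<Prod>j\<in>UNIV. if j = i then F i else 1)"
      by (intro prod.cong) (auto simp: lookup_single)
    then show ?thesis by simp
  qed
  have "sym_map ((*v) M) (sym_of w) = (\<Sum>i\<in>UNIV. sym_scale (w $ i) (sym_of (M *v axis i 1)))"
    unfolding sym_of_def[of w] sym_map_sum sym_map_single 1 ..
  also have "\<dots> = sym_of (\<Sum>i\<in>UNIV. w $ i *s (M *v axis i 1))"
    by (simp add: sym_of_sum sym_of_scale)
  also have "(\<Sum>i\<in>UNIV. w $ i *s (M *v axis i 1)) = M *v w"
    by (simp add: vec_eq_iff matrix_vector_mult_def axis_def mult.commute if_distrib cong: if_cong)
  finally show ?thesis .
qed

lemma sym_map_sym_of_power:
  fixes M :: "'k::field^'n^'n"
  shows "sym_map ((*v) M) (sym_of w ^ r) = sym_of (M *v w) ^ r"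
  by (simp add: sym_map_power sym_map_sym_of)

lemma sym_map_comp:
  fixes A B :: "'k::field^'n^'n"
  shows "sym_map ((*v) A) (sym_map ((*v) B) f) = sym_map ((*v) (A ** B)) f"
  unfolding sym_map_def[of "(*v) B"] sym_map_def[of "(*v) (A ** B)"]
  by (simp add: sym_map_sum sym_map_scale sym_map_prod sym_map_power sym_map_sym_of
      matrix_vector_mul_assoc)

lemma prod_single:
  "(\<Prod>a\<in>A. Poly_Mapping.single (g a) (1::'k::field)) = Poly_Mapping.single (\<Sum>a\<in>A. g a) 1"
  by (induction A rule: infinite_finite_induct) (auto simp: mult_single)

lemma single_single_power:
  "Poly_Mapping.single (Poly_Mapping.single i (1::nat)) (1::'k::field) ^ e =
     Poly_Mapping.single (Poly_Mapping.single i e) 1"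
  by (induction e) (auto simp: mult_single simp flip: single_add)

lemma prod_axis_power:
  fixes m :: "'n::finite \<Rightarrow>\<^sub>0 nat"
  shows "(\<Prod>i\<in>UNIV. (sym_of (axis i 1) :: ('k::field, 'n) sym) ^ Poly_Mapping.lookup m i) =
    Poly_Mapping.single m 1"
proof -
  have "(\<Sum>i\<in>UNIV. Poly_Mapping.single i (Poly_Mapping.lookup m i)) = m"
    by (rule sum_single_lookup[symmetric]) auto
  then show ?thesis
    by (simp only: sym_of_axis single_single_power prod_single)
qed

lemma sym_map_mat_1: "sym_map ((*v) (mat 1)) f = f"
proof -
  have "sym_map ((*v) (mat 1)) f =
      (\<Sum>m\<in>Poly_Mapping.keys f. Poly_Mapping.single m (Poly_Mapping.lookup f m))"
    by (simp add: sym_map_def prod_axis_power sym_scale_single)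
  also have "\<dots> = f"
    by (rule sum_single_lookup[symmetric]) auto
  finally show ?thesis .
qed

definition homogeneous :: "nat \<Rightarrow> ('k::field, 'n::finite) sym set" where
  "homogeneous r = {f. \<forall>m \<in> Poly_Mapping.keys f. (\<Sum>i\<in>UNIV. Poly_Mapping.lookup m i) = r}"

lemma homogeneous_altdef:
  "f \<in> homogeneous r \<longleftrightarrow>
     (\<forall>m. Poly_Mapping.lookup f m \<noteq> 0 \<longrightarrow> (\<Sum>i\<in>UNIV. Poly_Mapping.lookup m i) = r)"
  by (auto simp: homogeneous_def in_keys_iff)

lemma homogeneous_zero [simp]: "0 \<in> homogeneous r"
  by (simp add: homogeneous_def)

lemma homogeneous_add: "f \<in> homogeneous r \<Longrightarrow> g \<in> homogeneous r \<Longrightarrow> f + g \<in> homogeneous r"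
  unfolding homogeneous_altdef lookup_add by (metis add_0)

lemma homogeneous_scale: "f \<in> homogeneous r \<Longrightarrow> sym_scale c f \<in> homogeneous r"
  by (auto simp: homogeneous_altdef lookup_sym_scale)

lemma homogeneous_sum: "(\<And>a. a \<in> A \<Longrightarrow> f a \<in> homogeneous r) \<Longrightarrow> (\<Sum>a\<in>A. f a) \<in> homogeneous r"
  by (induction A rule: infinite_finite_induct) (auto simp: homogeneous_add)

lemma homogeneous_single: "(\<Sum>i\<in>UNIV. Poly_Mapping.lookup m i) = r \<Longrightarrow> Poly_Mapping.single m c \<in> homogeneous r"
  by (auto simp: homogeneous_altdef lookup_single when_def)

lemma homogeneous_mult:
  assumes "f \<in> homogeneous r" "g \<in> homogeneous s"
  shows "f * g \<in> homogeneous (r + s)"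
  unfolding homogeneous_def
proof safe
  fix m assume "m \<in> Poly_Mapping.keys (f * g)"
  then obtain a b where "m = a + b" "a \<in> Poly_Mapping.keys f" "b \<in> Poly_Mapping.keys g"
    using keys_mult by blast
  then show "(\<Sum>i\<in>UNIV. Poly_Mapping.lookup m i) = r + s"
    using assms by (auto simp: homogeneous_def lookup_add sum.distrib)
qed

lemma homogeneous_one [simp]: "1 \<in> homogeneous 0"
  using homogeneous_single[of 0 0 1] by simp

lemma homogeneous_power: "f \<in> homogeneous r \<Longrightarrow> f ^ e \<in> homogeneous (e * r)"
  by (induction e) (auto intro: homogeneous_mult)

lemma homogeneous_prod:
  "(\<And>a. a \<in> A \<Longrightarrow> f a \<in> homogeneous (r a)) \<Longrightarrow> (\<Prod>a\<in>A. f a) \<in> homogeneous (\<Sum>a\<in>A. r a)"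
  by (induction A rule: infinite_finite_induct) (auto intro: homogeneous_mult)

lemma homogeneous_sym_of: "sym_of v \<in> homogeneous 1"
  unfolding sym_of_def
  by (intro homogeneous_sum homogeneous_single) (simp add: lookup_single when_def)

lemma homogeneous_sym_map:
  assumes "f \<in> homogeneous r"
  shows "sym_map T f \<in> homogeneous r"
  unfolding sym_map_def
proof (intro homogeneous_sum homogeneous_scale)
  fix m assume "m \<in> Poly_Mapping.keys f"
  then have r: "r = (\<Sum>i\<in>UNIV. Poly_Mapping.lookup m i * 1)"
    using assms by (auto simp: homogeneous_def)
  show "(\<Prod>i\<in>UNIV. sym_of (T (axis i 1)) ^ Poly_Mapping.lookup m i) \<in> homogeneous r"
    unfolding r by (intro homogeneous_prod homogeneous_power homogeneous_sym_of)
qed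

section \<open>Binary forms\<close>

definition binary_monomial :: "nat \<Rightarrow> nat \<Rightarrow> 2 \<Rightarrow>\<^sub>0 nat" where
  "binary_monomial r i = Poly_Mapping.single 1 i + Poly_Mapping.single 2 (r - i)"

lemma lookup_binary_monomial:
  "Poly_Mapping.lookup (binary_monomial r i) 1 = i"
  "Poly_Mapping.lookup (binary_monomial r i) 2 = r - i"
  by (simp_all add: binary_monomial_def lookup_add lookup_single when_def)

lemma inj_binary_monomial: "inj (binary_monomial r)"
  by (metis injI lookup_binary_monomial(1))

lemma degree_eq_binary_monomial:
  "(\<Sum>i\<in>UNIV. Poly_Mapping.lookup m i) = r \<longleftrightarrow> m \<in> binary_monomial r ` {..r}"
proof
  assume *: "(\<Sum>i\<in>UNIV. Poly_Mapping.lookup m i) = r"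
  have "m = binary_monomial r (Poly_Mapping.lookup m 1)"
  proof (rule poly_mapping_eqI)
    fix k :: 2
    have "k = 1 \<or> k = 2" by (rule exhaust_2)
    then show "Poly_Mapping.lookup m k =
        Poly_Mapping.lookup (binary_monomial r (Poly_Mapping.lookup m 1)) k"
      using * by (auto simp: lookup_binary_monomial sum_2)
  qed
  then show "m \<in> binary_monomial r ` {..r}"
    using * by (auto simp: sum_2)
qed (auto simp: sum_2 lookup_binary_monomial)

lemma homogeneous_eq_sum_binary_monomials:
  assumes "f \<in> homogeneous r"
  shows "f = (\<Sum>i\<le>r. Poly_Mapping.single (binary_monomial r i) (Poly_Mapping.lookup f (binary_monomial r i)))"
proof -
  have "f = (\<Sum>m\<in>binary_monomial r ` {..r}. Poly_Mapping.single m (Poly_Mapping.lookup f m))"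
    using assms degree_eq_binary_monomial by (intro sum_single_lookup) (auto simp: homogeneous_def)
  then show ?thesis
    by (simp add: sum.reindex inj_on_subset[OF inj_binary_monomial])
qed

lemma homogeneous_binary_monomial: "i \<le> r \<Longrightarrow> Poly_Mapping.single (binary_monomial r i) c \<in> homogeneous r"
  using degree_eq_binary_monomial by (intro homogeneous_single) blast

lemma homogeneous_subset_span:
  fixes B :: "('k::field, 2) sym set"
  assumes "sym.independent B" "B \<subseteq> homogeneous r" "card B = Suc r"
  shows "homogeneous r \<subseteq> sym.span B"
proof -
  define M :: "('k, 2) sym set" where "M = (\<lambda>i. Poly_Mapping.single (binary_monomial r i) 1) ` {..r}"
  have M: "finite M" "card M \<le> Suc r"
    unfolding M_def by (auto intro: order.trans[OF card_image_le])
  have span: "homogeneous r \<subseteq> sym.span M"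
  proof
    fix f :: "('k, 2) sym" assume f: "f \<in> homogeneous r"
    have "(\<Sum>i\<le>r. sym_scale (Poly_Mapping.lookup f (binary_monomial r i))
        (Poly_Mapping.single (binary_monomial r i) 1)) \<in> sym.span M"
      by (intro sym.span_sum sym.span_scale sym.span_base) (auto simp: M_def)
    then show "f \<in> sym.span M"
      using homogeneous_eq_sum_binary_monomials[OF f] by (simp add: sym_scale_single)
  qed
  have "finite B" using assms(3) by (simp add: card_ge_0_finite)
  show ?thesis
  proof (rule ccontr)
    assume "\<not> ?thesis"
    then obtain f where f: "f \<in> homogeneous r" "f \<notin> sym.span B" by auto
    then have "sym.independent (insert f B)" "insert f B \<subseteq> sym.span M"
      using assms(1,2) span by (auto simp: sym.independent_insertI)
    then have "card (insert f B) \<le> card M"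
      using sym.independent_span_bound[OF M(1)] by blast
    moreover have "f \<notin> B" using f(2) sym.span_base by blast
    ultimately show False
      using M(2) assms(3) \<open>finite B\<close> by simp
  qed
qed

section \<open>Finite subgroups of the additive group\<close>

lemma binomial_prime_power_nonzero:
  assumes p: "prime p" "CHAR('k::field) = p" and i: "i < p ^ n"
  shows "of_nat ((p ^ n - 1) choose i) \<noteq> (0::'k)"
  using i
proof (induction i)
  case (Suc i)
  have "Suc i * (p ^ n choose Suc i) = p ^ n * ((p ^ n - 1) choose i)"
    using times_binomial_minus1_eq[of "Suc i" "p ^ n"] by simp
  then have dvd: "p ^ n dvd Suc i * (p ^ n choose Suc i)"
    by (metis dvd_triv_left)
  have "p dvd (p ^ n choose Suc i)"
  proof (rule ccontr)
    assume "\<not> ?thesis"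
    then have "coprime (p ^ n) (p ^ n choose Suc i)"
      using p(1) by (simp add: prime_imp_coprime)
    then have "p ^ n dvd Suc i"
      using dvd coprime_dvd_mult_left_iff by blast
    then show False using Suc.prems by (auto dest: dvd_imp_le)
  qed
  then have "of_nat (p ^ n choose Suc i) = (0::'k)"
    using p(2) by (simp add: of_nat_eq_0_iff_char_dvd)
  moreover have "p ^ n choose Suc i = ((p ^ n - 1) choose i) + ((p ^ n - 1) choose Suc i)"
    using Suc.prems by (cases "p ^ n") auto
  ultimately have "of_nat ((p ^ n - 1) choose Suc i) = - (of_nat ((p ^ n - 1) choose i) :: 'k)"
    by (metis add.commute eq_neg_iff_add_eq_0 of_nat_add)
  then show ?case using Suc by simp
qed auto

lemma shifted_powers_independent:
  fixes a :: "'k::field \<Rightarrow> 'k"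
  assumes p: "prime p" "CHAR('k) = p" and inf: "infinite (UNIV :: 'k set)"
    and E: "finite E" "card E = p ^ n"
    and zero: "\<And>x. (\<Sum>c\<in>E. a c * (c - x) ^ (p ^ n - 1)) = 0" and e: "e \<in> E"
  shows "a e = 0"
proof -
  define r where "r = p ^ n - 1"
  define P where "P = (\<Sum>c\<in>E. Polynomial.smult (a c) ([:c, -1:] ^ r))"
  have "poly P x = 0" for x
    using zero[of x] by (simp add: P_def poly_sum r_def algebra_simps)
  then have P: "P = 0"
    using inf poly_roots_finite[of P] by auto
  have moment: "(\<Sum>c\<in>E. a c * c ^ j) = 0" if "j \<le> r" for j
  proof -
    have rj: "r - (r - j) = j" using that by simp
    have "0 = coeff P (r - j)" by (simp add: P)
    also have "\<dots> = (\<Sum>c\<in>E. a c * (of_nat (r choose (r - j)) * (- 1) ^ (r - j) * c ^ j))"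
      unfolding P_def by (simp add: coeff_sum coeff_linear_poly_power rj)
    also have "\<dots> = of_nat (r choose (r - j)) * (- 1) ^ (r - j) * (\<Sum>c\<in>E. a c * c ^ j)"
      by (simp add: sum_distrib_left algebra_simps)
    finally show ?thesis
      using binomial_prime_power_nonzero[OF p, of "r - j" n] that p(1)
      by (auto simp: r_def prime_gt_0_nat)
  qed
  define L where "L = (\<Prod>b\<in>E - {e}. [:- b, 1:])"
  have deg: "degree L \<le> r"
    unfolding L_def using E e
    by (intro order.trans[OF degree_prod_sum_le]) (auto simp: r_def)
  have "(\<Sum>c\<in>E. a c * poly L c) = (\<Sum>c\<in>E. \<Sum>j\<le>degree L. coeff L j * (a c * c ^ j))"
    by (simp add: poly_altdef sum_distrib_left algebra_simps)
  also have "\<dots> = (\<Sum>j\<le>degree L. coeff L j * (\<Sum>c\<in>E. a c * c ^ j))"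
    by (subst sum.swap) (simp add: sum_distrib_left)
  also have "\<dots> = 0"
    using deg moment by (intro sum.neutral) auto
  finally have "(\<Sum>c\<in>E. a c * poly L c) = 0" .
  moreover have "(\<Sum>c\<in>E. a c * poly L c) = (\<Sum>c\<in>{e}. a c * poly L c)"
    using E e by (intro sum.mono_neutral_right) (auto simp: L_def poly_prod)
  moreover have "poly L e \<noteq> 0"
    using E by (auto simp: L_def poly_prod)
  ultimately show ?thesis by simp
qed

lemma add_closed_of_nat_mult:
  fixes T :: "'k::semiring_1 set"
  assumes "0 \<in> T" "\<And>x y. x \<in> T \<Longrightarrow> y \<in> T \<Longrightarrow> x + y \<in> T" "x \<in> T"
  shows "of_nat m * x \<in> T"
  using assms by (induction m) (auto simp: algebra_simps)

lemma uminus_eq_of_nat_mult: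
  fixes x :: "'k::field"
  assumes "CHAR('k) > 0"
  shows "- x = of_nat (CHAR('k) - 1) * x"
proof -
  have "of_nat (CHAR('k) - 1) = (- 1 :: 'k)"
    using assms by (simp add: of_nat_diff)
  then show ?thesis by simp
qed

lemma finite_subgroup_extend:
  fixes E :: "'k::field set"
  assumes p: "prime p" "CHAR('k) = p"
    and E: "finite E" "0 \<in> E" "\<And>x y. x \<in> E \<Longrightarrow> y \<in> E \<Longrightarrow> x + y \<in> E" and t: "t \<notin> E"
  defines "E' \<equiv> (\<lambda>(e, i). e + of_nat i * t) ` (E \<times> {..<p})"
  shows "card E' = p * card E" "0 \<in> E'" "\<And>x y. x \<in> E' \<Longrightarrow> y \<in> E' \<Longrightarrow> x + y \<in> E'"
proof -
  have neg: "- x \<in> E" if "x \<in> E" for x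
    using add_closed_of_nat_mult[OF E(2,3) that] uminus_eq_of_nat_mult[of x] p prime_gt_0_nat by metis
  have *: "\<not> i < j" if "e + of_nat i * t = e' + of_nat j * t" "e \<in> E" "e' \<in> E" "j < p" for e e' i j
  proof
    assume ij: "i < j"
    have "of_nat (j - i) * t = e + - e'"
      using that ij by (simp add: of_nat_diff algebra_simps)
    then have mem: "of_nat (j - i) * t \<in> E" using E(3) that(2) neg[OF that(3)] by metis
    have "coprime (j - i) p"
      using ij that(4) p(1) by (metis coprime_commute dvd_imp_le leD less_imp_diff_less prime_imp_coprime zero_less_diff)
    then obtain m where "[(j - i) * m = 1] (mod p)"
      using cong_solve_coprime_nat[of "j - i" p] by auto
    then have "(of_nat ((j - i) * m) :: 'k) = of_nat 1"
      using p(2) of_nat_eq_iff_cong_CHAR by blast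
    then have "of_nat m * (of_nat (j - i) * t) = t"
      by (metis mult.assoc mult.commute mult.left_neutral of_nat_1 of_nat_mult)
    then show False
      using add_closed_of_nat_mult[OF E(2,3) mem, of m] t by metis
  qed
  have "inj_on (\<lambda>(e, i). e + of_nat i * t) (E \<times> {..<p})"
  proof (rule inj_onI, clarsimp)
    fix e i e' j
    assume "e \<in> E" "i < p" "e' \<in> E" "j < p" and eq: "e + of_nat i * t = e' + of_nat j * t"
    then have "i = j" using *[OF eq] *[OF eq[symmetric]] by (meson linorder_neqE_nat)
    then show "e = e' \<and> i = j" using eq by simp
  qed
  then show "card E' = p * card E"
    unfolding E'_def by (simp add: card_image card_cartesian_product)
  show "0 \<in> E'"
    unfolding E'_def using E(2) p(1) prime_gt_0_nat by (force intro!: image_eqI[of _ _ "(0, 0)"])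
  fix x y assume "x \<in> E'" "y \<in> E'"
  then obtain e i e' j where xy: "x = e + of_nat i * t" "y = e' + of_nat j * t" "e \<in> E" "e' \<in> E"
    by (auto simp: E'_def)
  have "x + y = (e + e') + of_nat (i + j) * t"
    by (simp add: xy algebra_simps)
  also have "(of_nat (i + j) :: 'k) = of_nat ((i + j) mod p)"
    unfolding of_nat_eq_iff_cong_CHAR p(2) by (simp add: cong_def)
  finally show "x + y \<in> E'"
    unfolding E'_def using E(3) xy p(1) prime_gt_0_nat by (force intro!: image_eqI[of _ _ "(e + e', (i + j) mod p)"])
qed

lemma exists_finite_subgroup:
  fixes T :: "'k::field set"
  assumes p: "prime p" "CHAR('k) = p"
    and T: "infinite T" "0 \<in> T" "\<And>x y. x \<in> T \<Longrightarrow> y \<in> T \<Longrightarrow> x + y \<in> T"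
  shows "\<exists>E\<subseteq>T. finite E \<and> card E = p ^ n \<and> 0 \<in> E \<and> (\<forall>x\<in>E. \<forall>y\<in>E. x + y \<in> E)"
proof (induction n)
  case 0
  then show ?case using T by (intro exI[of _ "{0}"]) auto
next
  case (Suc n)
  then obtain E where E: "E \<subseteq> T" "finite E" "card E = p ^ n" "0 \<in> E" "\<And>x y. x \<in> E \<Longrightarrow> y \<in> E \<Longrightarrow> x + y \<in> E"
    by auto
  obtain t where t: "t \<in> T" "t \<notin> E"
    using E(1,2) T(1) by (meson finite_subset subsetI)
  let ?E = "(\<lambda>(e, i). e + of_nat i * t) ` (E \<times> {..<p})"
  have "?E \<subseteq> T"
    using E(1) T(3) add_closed_of_nat_mult[OF T(2,3) t(1)] by auto
  then show ?case
    using finite_subgroup_extend[OF p E(2,4,5) t(2)] E(2,3) by (intro exI[of _ ?E]) auto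
qed

lemma sum_Pow_translation_invariant:
  fixes E :: "'k::field set" and g :: "'k set \<Rightarrow> 'k"
  assumes p: "prime p" "CHAR('k) = p"
    and E: "finite E" "card E = p ^ n" "0 \<in> E" "\<And>x y. x \<in> E \<Longrightarrow> y \<in> E \<Longrightarrow> x + y \<in> E"
    and g: "\<And>A e. A \<subseteq> E \<Longrightarrow> e \<in> E \<Longrightarrow> g ((+) e ` A) = g A"
  shows "(\<Sum>A\<in>Pow E. g A) = g {} + g E"
proof -
  have neg: "- x \<in> E" if "x \<in> E" for x
    using add_closed_of_nat_mult[OF E(3,4) that] uminus_eq_of_nat_mult[of x] p prime_gt_0_nat by metis
  define orb where "orb A = (\<lambda>e. (+) e ` A) ` E" for A
  define X where "X = Pow E - {{}, E}"
  have tr: "(+) e ` (+) e' ` A = (+) (e + e') ` A" for e e' and A :: "'k set"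
    by (auto simp: image_image add.assoc)
  have self: "A \<in> orb A" for A
    unfolding orb_def using E(3) by (force intro: image_eqI[of _ _ 0])
  have orb_eq: "orb B = orb A" if "B \<in> orb A" for A B
  proof -
    have sub: "orb C \<subseteq> orb D" if "C \<in> orb D" for C D
      using that E(4) by (auto simp: orb_def tr)
    from \<open>B \<in> orb A\<close> obtain e where e: "e \<in> E" "B = (+) e ` A" by (auto simp: orb_def)
    then have "A = (+) (- e) ` B" by (simp only: tr) simp
    then have "A \<in> orb B" using neg[OF e(1)] unfolding orb_def by (rule image_eqI)
    then show ?thesis using sub \<open>B \<in> orb A\<close> by blast
  qed
  have E_tr: "(+) e ` E = E" if "e \<in> E" for e
    using E that by (intro card_subset_eq) (auto simp: card_image)
  have orb_X: "orb A \<subseteq> X" if A: "A \<in> X" for A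
  proof
    fix B assume B: "B \<in> orb A"
    then obtain e where e: "e \<in> E" "B = (+) e ` A" by (auto simp: orb_def)
    have "A = (+) (- e) ` B" by (simp only: tr e) simp
    then have "B \<noteq> E" using E_tr[OF neg[OF e(1)]] A by (auto simp: X_def)
    then show "B \<in> X" using A e E(4) by (auto simp: X_def)
  qed
  have zero: "(\<Sum>B\<in>orb A. g B) = 0" if A: "A \<in> X" for A
  proof -
    define H where "H = {e\<in>E. (+) e ` A = A}"
    have "card E = (\<Sum>B\<in>orb A. card {e\<in>E. (+) e ` A = B})"
      using sum.image_gen[OF E(1), of "\<lambda>_. 1::nat" "\<lambda>e. (+) e ` A"] E(1) by (simp add: orb_def)
    also have "\<dots> = (\<Sum>B\<in>orb A. card H)"
    proof (intro sum.cong refl)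
      fix B assume "B \<in> orb A"
      then obtain e where e: "e \<in> E" "B = (+) e ` A" by (auto simp: orb_def)
      have "{e'\<in>E. (+) e' ` A = B} = (+) e ` H"
      proof (intro equalityI subsetI)
        fix e' assume "e' \<in> {e'\<in>E. (+) e' ` A = B}"
        then have e': "e' \<in> E" "(+) e' ` A = B" by auto
        have "(+) (- e + e') ` A = (+) (- e) ` (+) e' ` A" by (simp only: tr)
        also have "\<dots> = A" unfolding e'(2) e(2) tr by simp
        finally have "- e + e' \<in> H"
          using E(4)[OF neg[OF e(1)] e'(1)] by (simp add: H_def)
        then show "e' \<in> (+) e ` H" by (intro image_eqI[of _ _ "- e + e'"]) auto
      next
        fix x assume "x \<in> (+) e ` H"
        then obtain h where h: "h \<in> H" "x = e + h" by auto
        have "(+) (e + h) ` A = (+) e ` (+) h ` A" by (simp only: tr)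
        also have "(+) h ` A = A" using h by (simp add: H_def)
        finally show "x \<in> {e'\<in>E. (+) e' ` A = B}"
          using e h E(4) by (auto simp: H_def)
      qed
      then show "card {e'\<in>E. (+) e' ` A = B} = card H"
        by (simp add: card_image)
    qed
    finally have "card (orb A) dvd p ^ n" using E(2) by simp
    moreover have "card (orb A) \<noteq> 1"
    proof
      assume "card (orb A) = 1"
      then have *: "B = A" if "B \<in> orb A" for B
        using self[of A] that by (auto simp: card_1_singleton_iff)
      obtain a b where ab: "a \<in> A" "b \<in> E" "b \<notin> A" "A \<subseteq> E" using A by (auto simp: X_def)
      then have "b + - a \<in> E" using E(4) neg by blast
      then have "(+) (b + - a) ` A = A" using * by (auto simp: orb_def)
      then have "(b + - a) + a \<in> A" using ab(1) by blast
      then show False using ab by simp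
    qed
    ultimately have "p dvd card (orb A)"
      using p(1) by (metis divides_primepow_nat dvd_power gr0I power_0)
    then have "of_nat (card (orb A)) = (0::'k)" using p(2) by (simp add: of_nat_eq_0_iff_char_dvd)
    moreover have "(\<Sum>B\<in>orb A. g B) = (\<Sum>B\<in>orb A. g A)"
      using g A by (intro sum.cong) (auto simp: orb_def X_def)
    ultimately show ?thesis by simp
  qed
  have finX: "finite X" using E(1) by (simp add: X_def)
  have "(\<Sum>A\<in>X. g A) = (\<Sum>C\<in>orb ` X. \<Sum>A\<in>{A\<in>X. orb A = C}. g A)"
    by (rule sum.image_gen[OF finX])
  also have "\<dots> = 0"
  proof (rule sum.neutral, rule ballI)
    fix C assume "C \<in> orb ` X"
    then obtain A where A: "A \<in> X" "C = orb A" by auto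
    have "{B\<in>X. orb B = C} = orb A"
      using A orb_X[OF A(1)] orb_eq self by blast
    then show "(\<Sum>B\<in>{B\<in>X. orb B = C}. g B) = 0" using zero[OF A(1)] by simp
  qed
  finally have "(\<Sum>A\<in>X. g A) = 0" .
  moreover have "Pow E = {{}, E} \<union> X" "{{}, E} \<inter> X = {}" "{} \<noteq> E"
    using E(3) by (auto simp: X_def)
  ultimately show ?thesis
    using finX by (simp only: sum.union_disjoint) simp
qed

section \<open>Finite differences of set functions\<close>

text \<open>
  Polynomials of degree at most \<open>d\<close> in the indicator variables of \<open>A\<close>. These variables are
  idempotent, so squarefree monomials, given by the finite sets \<open>B\<close>, suffice.
\<close>

inductive set_poly :: "nat \<Rightarrow> ('a set \<Rightarrow> 'k::comm_ring_1) \<Rightarrow> bool" for d where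
  zero: "set_poly d (\<lambda>_. 0)"
| add_monomial: "set_poly d F \<Longrightarrow> finite B \<Longrightarrow> card B \<le> d
    \<Longrightarrow> set_poly d (\<lambda>A. F A + c * of_bool (B \<subseteq> A))"

lemma set_poly_monomial: "finite B \<Longrightarrow> card B \<le> d \<Longrightarrow> set_poly d (\<lambda>A. c * of_bool (B \<subseteq> A))"
  using set_poly.add_monomial[OF set_poly.zero] by simp

lemma set_poly_add:
  assumes "set_poly d F" "set_poly d H"
  shows "set_poly d (\<lambda>A. F A + H A)"
  using assms(2) by induction (auto intro: set_poly.intros assms(1) simp flip: add.assoc)

lemma set_poly_sum: "(\<And>i. i \<in> I \<Longrightarrow> set_poly d (F i)) \<Longrightarrow> set_poly d (\<lambda>A. \<Sum>i\<in>I. F i A)"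
  by (induction I rule: infinite_finite_induct) (auto intro: set_poly_add set_poly.zero)

lemma set_poly_monomial_mult:
  assumes "set_poly e H" "finite B" "card B \<le> d"
  shows "set_poly (d + e) (\<lambda>A. c * of_bool (B \<subseteq> A) * H A)"
  using assms(1)
proof induction
  case zero
  then show ?case using set_poly.zero by simp
next
  case (add_monomial H B' c')
  have "card (B \<union> B') \<le> d + e"
    using assms add_monomial by (intro order.trans[OF card_Un_le]) auto
  then have "set_poly (d + e) (\<lambda>A. c * of_bool (B \<subseteq> A) * H A + c * c' * of_bool (B \<union> B' \<subseteq> A))"
    using add_monomial assms by (intro set_poly.add_monomial) auto
  also have "(\<lambda>A. c * of_bool (B \<subseteq> A) * H A + c * c' * of_bool (B \<union> B' \<subseteq> A)) =
      (\<lambda>A. c * of_bool (B \<subseteq> A) * (H A + c' * of_bool (B' \<subseteq> A)))"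
    by (auto simp: fun_eq_iff algebra_simps)
  finally show ?case .
qed

lemma set_poly_mult:
  assumes "set_poly d F" "set_poly e H"
  shows "set_poly (d + e) (\<lambda>A. F A * H A)"
  using assms(1)
proof induction
  case zero
  then show ?case using set_poly.zero by simp
next
  case (add_monomial F B c)
  then have "set_poly (d + e) (\<lambda>A. F A * H A + c * of_bool (B \<subseteq> A) * H A)"
    using set_poly_monomial_mult[OF assms(2)] by (intro set_poly_add) auto
  then show ?case by (simp add: algebra_simps)
qed

lemma sum_Pow_insert:
  assumes "finite E" "e \<notin> E"
  shows "(\<Sum>A\<in>Pow (insert e E). g A) = (\<Sum>A\<in>Pow E. g A + g (insert e A))"
proof -
  have "inj_on (insert e) (Pow E)" using assms by (auto simp: inj_on_def)
  moreover have "Pow E \<inter> insert e ` Pow E = {}" using assms by auto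
  ultimately show ?thesis
    using assms by (auto simp: Pow_insert sum.union_disjoint sum.reindex sum.distrib)
qed

lemma set_poly_alternating_sum:
  assumes "set_poly d F" "finite E" "d < card E"
  shows "(\<Sum>A\<in>Pow E. (- 1) ^ card A * F A) = 0"
  using assms(1)
proof induction
  case (add_monomial F B c)
  have "\<not> E \<subseteq> B"
    using add_monomial assms(3) by (meson card_mono le_trans not_le)
  then obtain e where e: "e \<in> E" "e \<notin> B" by auto
  define E' where "E' = E - {e}"
  have E': "E = insert e E'" "e \<notin> E'" "finite E'" using e assms by (auto simp: E'_def)
  have "(\<Sum>A\<in>Pow E. (- 1) ^ card A * (c * of_bool (B \<subseteq> A))) = 0"
    unfolding E'(1) sum_Pow_insert[OF E'(3,2)]
  proof (intro sum.neutral ballI)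
    fix A assume A: "A \<in> Pow E'"
    then have "finite A" "e \<notin> A" using E' finite_subset by auto
    moreover have "B \<subseteq> insert e A \<longleftrightarrow> B \<subseteq> A" using e by auto
    ultimately show "(- 1) ^ card A * (c * of_bool (B \<subseteq> A)) +
        (- 1) ^ card (insert e A) * (c * of_bool (B \<subseteq> insert e A)) = 0" by simp
  qed
  then show ?case using add_monomial by (simp add: distrib_left sum.distrib)
qed auto

section \<open>Unipotent subgroups of rank two\<close>

lemma unipotent_2x2:
  fixes A :: "'k::field^2^2"
  assumes "unipotent A"
  defines "B \<equiv> A - mat 1"
  shows "B $ 2 $ 2 = - B $ 1 $ 1" "B $ 1 $ 1 ^ 2 + B $ 1 $ 2 * B $ 2 $ 1 = 0"
proof -
  obtain k where k: "(((**) B) ^^ k) (mat 1) = 0"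
    using assms by (auto simp: unipotent_def)
  have "det ((((**) B) ^^ j) (mat 1)) = det B ^ j" for j
    by (induction j) (auto simp: det_mul)
  from this[of k] k have "det B = 0" by (simp add: det_2)
  then have d: "B $ 1 $ 1 * B $ 2 $ 2 = B $ 1 $ 2 * B $ 2 $ 1"
    by (simp add: det_2)
  define t where "t = B $ 1 $ 1 + B $ 2 $ 2"
  have sq: "(B ** B) $ i $ l = t * B $ i $ l" for i l
    using d exhaust_2[of i] exhaust_2[of l]
    by (auto simp: matrix_matrix_mult_def sum_2 t_def algebra_simps)
  have pow: "(((**) B) ^^ Suc j) (mat 1) = (\<chi> i l. t ^ j * B $ i $ l)" for j
  proof (induction j)
    case (Suc j)
    have "(((**) B) ^^ Suc (Suc j)) (mat 1) = B ** (\<chi> i l. t ^ j * B $ i $ l)"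
      using Suc by simp
    also have "\<dots> = (\<chi> i l. t ^ j * (B ** B) $ i $ l)"
      by (simp add: vec_eq_iff matrix_matrix_mult_def sum_distrib_left algebra_simps)
    finally show ?case by (simp add: sq algebra_simps)
  qed auto
  have "t = 0"
  proof (cases k)
    case 0
    then have "(mat 1 :: 'k^2^2) $ 1 $ 1 = 0" using k by simp
    then show ?thesis by (simp add: mat_def)
  next
    case (Suc j)
    then have "(\<chi> i l. t ^ j * B $ i $ l) = 0" using k pow by metis
    then have "((\<chi> i l. t ^ j * B $ i $ l) :: 'k^2^2) $ i $ l = 0" for i l by simp
    then have "t ^ j * B $ i $ l = 0" for i l by simp
    from this[of 1 1] this[of 2 2] have "t = 0 \<or> B $ 1 $ 1 + B $ 2 $ 2 = 0" by auto
    then show ?thesis by (simp add: t_def)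
  qed
  then show tr: "B $ 2 $ 2 = - B $ 1 $ 1" by (metis t_def eq_neg_iff_add_eq_0 add.commute)
  show "B $ 1 $ 1 ^ 2 + B $ 1 $ 2 * B $ 2 $ 1 = 0"
    unfolding d[unfolded tr, symmetric] by (simp add: power2_eq_square)
qed

lemma matrix_mult_add_right_distrib: "(A + B) ** C = A ** C + B ** (C :: 'k::semiring_1^'n^'n)"
  by (simp add: vec_eq_iff matrix_matrix_mult_def sum.distrib algebra_simps)

definition shear :: "'k::field^2^2 \<Rightarrow> 'k \<Rightarrow> 'k^2^2" where
  "shear N t = mat 1 + (\<chi> i j. t * N $ i $ j)"

lemma shear_0: "shear N 0 = mat 1"
  by (simp add: shear_def vec_eq_iff)

lemma shear_add: "N ** N = 0 \<Longrightarrow> shear N s ** shear N t = shear N (s + t)"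
proof -
  assume N: "N ** N = 0"
  have sc: "(\<chi> i j. s * N $ i $ j) ** (\<chi> i j. t * N $ i $ j) = 0"
  proof -
    have "(\<chi> i j. s * N $ i $ j) ** (\<chi> i j. t * N $ i $ j) = (\<chi> i j. s * t * (N ** N) $ i $ j)"
      by (simp add: vec_eq_iff matrix_matrix_mult_def sum_distrib_left algebra_simps)
    then show ?thesis by (simp add: N vec_eq_iff)
  qed
  have "shear N s ** shear N t = mat 1 + (\<chi> i j. s * N $ i $ j) + (\<chi> i j. t * N $ i $ j) +
      (\<chi> i j. s * N $ i $ j) ** (\<chi> i j. t * N $ i $ j)"
    by (simp add: shear_def matrix_add_ldistrib matrix_mult_add_right_distrib)
  then show ?thesis unfolding sc by (simp add: shear_def vec_eq_iff algebra_simps)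
qed

lemma shear_vec: "shear N t *v w = w + t *s (N *v w)"
  by (simp add: shear_def matrix_vector_mult_add_rdistrib)
    (simp add: vec_eq_iff matrix_vector_mult_def sum_distrib_left algebra_simps)

lemma unipotent_subgroup_2x2:
  fixes U :: "('k::field^2^2) set"
  assumes U: "subgroup U GL" "infinite U" "\<And>u. u \<in> U \<Longrightarrow> unipotent u"
  obtains N e where "N ** N = 0" "(N *v e) $ 1 * e $ 2 \<noteq> (N *v e) $ 2 * e $ 1"
    "U \<subseteq> range (shear N)"
proof -
  have "U \<noteq> {mat 1}" "mat 1 \<in> U"
    using U(2) subgroup.one_closed[OF U(1)] by (auto simp: GL_def)
  then obtain A where A: "A \<in> U" "A \<noteq> mat 1" by auto
  define N where "N = A - mat 1"
  define a b c where "a = N $ 1 $ 1" and "b = N $ 1 $ 2" and "c = N $ 2 $ 1"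
  have N: "N $ 1 $ 1 = a" "N $ 1 $ 2 = b" "N $ 2 $ 1 = c" "N $ 2 $ 2 = - a"
    and sq: "a ^ 2 + b * c = 0"
    using unipotent_2x2[OF U(3)[OF A(1)]] by (auto simp: N_def a_def b_def c_def)
  have N0: "N \<noteq> 0" using A(2) by (simp add: N_def)
  have bc: "b \<noteq> 0 \<or> c \<noteq> 0"
  proof (rule ccontr)
    assume "\<not> ?thesis"
    then have "b = 0" "c = 0" "a = 0" using sq by auto
    then show False using N0 by (simp add: vec_eq_iff forall_2 N)
  qed
  have NN: "N ** N = 0"
  proof -
    have "a * a + b * c = 0" "c * b = - (a * a)"
      using sq by (simp_all add: power2_eq_square add_eq_0_iff mult.commute)
    then show ?thesis
      by (simp add: vec_eq_iff forall_2 matrix_matrix_mult_def sum_2 N)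
  qed
  have "B \<in> range (shear N)" if B: "B \<in> U" for B
  proof -
    define M where "M = B - mat 1"
    define x y z where "x = M $ 1 $ 1" and "y = M $ 1 $ 2" and "z = M $ 2 $ 1"
    have M: "M $ 1 $ 1 = x" "M $ 1 $ 2 = y" "M $ 2 $ 1 = z" "M $ 2 $ 2 = - x"
      and sqM: "x ^ 2 + y * z = 0"
      using unipotent_2x2[OF U(3)[OF B]] by (auto simp: M_def x_def y_def z_def)
    have "A ** B \<in> U" using subgroup.m_closed[OF U(1) A(1) B] by (simp add: GL_def)
    moreover have "A ** B = mat 1 + N + M + N ** M"
    proof -
      have "A ** B = (mat 1 + N) ** (mat 1 + M)" by (simp add: N_def M_def)
      then show ?thesis by (simp only: matrix_add_ldistrib matrix_mult_add_right_distrib) (simp add: add_ac)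
    qed
    ultimately have "unipotent (mat 1 + N + M + N ** M)" using U(3) by metis
    from unipotent_2x2(1)[OF this]
    have eq: "- a + - x + (c * y + a * x) = - (a + x + (a * x + b * z))"
      by (simp add: matrix_matrix_mult_def sum_2 N M)
    have "2 * a * x + b * z + c * y =
        (- a + - x + (c * y + a * x)) + (a + x + (a * x + b * z))"
      by (simp add: algebra_simps)
    then have tr: "2 * a * x + b * z + c * y = 0" unfolding eq by simp
    have "(a * z - c * x) ^ 2 = 0"
    proof -
      have "(a * z - c * x) ^ 2 = (a ^ 2 + b * c) * z ^ 2 + (x ^ 2 + y * z) * c ^ 2 - c * z * (2 * a * x + b * z + c * y)"
        by (simp add: power2_eq_square algebra_simps)
      then show ?thesis by (simp add: sq sqM tr)
    qed
    moreover have "(a * y - b * x) ^ 2 = 0"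
    proof -
      have "(a * y - b * x) ^ 2 = (a ^ 2 + b * c) * y ^ 2 + (x ^ 2 + y * z) * b ^ 2 - b * y * (2 * a * x + b * z + c * y)"
        by (simp add: power2_eq_square algebra_simps)
      then show ?thesis by (simp add: sq sqM tr)
    qed
    moreover have "(b * z - c * y) ^ 2 = 0"
    proof -
      have "(b * z - c * y) ^ 2 = (2 * a * x + b * z + c * y) * (b * z + c * y - 2 * a * x)
          + 4 * (a ^ 2 * (x ^ 2 + y * z)) - 4 * (y * z * (a ^ 2 + b * c))"
        by (simp add: power2_eq_square algebra_simps)
      then show ?thesis by (simp add: sq sqM tr)
    qed
    ultimately have cross: "a * z = c * x" "a * y = b * x" "b * z = c * y" by auto
    have "\<exists>t. x = t * a \<and> y = t * b \<and> z = t * c"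
    proof -
      consider "b \<noteq> 0" | "c \<noteq> 0" using bc by blast
      then show ?thesis
      proof cases
        case 1
        then show ?thesis using cross by (intro exI[of _ "y / b"]) (auto simp: field_simps)
      next
        case 2
        then show ?thesis using cross by (intro exI[of _ "z / c"]) (auto simp: field_simps)
      qed
    qed
    then obtain t where "x = t * a" "y = t * b" "z = t * c" by auto
    then have "M = (\<chi> i j. t * N $ i $ j)"
      by (simp add: vec_eq_iff forall_2 N M)
    moreover have "B = mat 1 + M" by (simp add: M_def)
    ultimately show ?thesis unfolding shear_def by blast
  qed
  moreover have "\<exists>e. (N *v e) $ 1 * e $ 2 \<noteq> (N *v e) $ 2 * e $ 1"
  proof (cases "c = 0")
    case True
    then have "b \<noteq> 0" "a = 0" using bc sq by auto
    then show ?thesis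
      by (intro exI[of _ "axis 2 1"]) (simp add: matrix_vector_mult_def sum_2 N axis_def)
  next
    case False
    then show ?thesis
      by (intro exI[of _ "axis 1 1"]) (simp add: matrix_vector_mult_def sum_2 N axis_def)
  qed
  ultimately show ?thesis using that NN by blast
qed

lemma poly_fun_set_poly:
  fixes W :: "('g, 'k::field, 'w::ab_group_add) rep"
  assumes f: "poly_fun W d f" and E: "finite E"
    and W: "0 \<in> vecs W" "\<And>x y. x \<in> vecs W \<Longrightarrow> y \<in> vecs W \<Longrightarrow> x + y \<in> vecs W"
    and \<phi>: "\<And>c. c \<in> E \<Longrightarrow> \<phi> c \<in> vecs W"
  shows "\<exists>F. set_poly d F \<and> (\<forall>A\<subseteq>E. f (\<Sum>c\<in>A. \<phi> c) = F A)"
  using f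
proof induction
  case (const d c)
  then show ?case
    by (intro exI[of _ "\<lambda>A. c * of_bool ({} \<subseteq> A)"] conjI set_poly_monomial) auto
next
  case (linear l d)
  let ?F = "\<lambda>A. \<Sum>c\<in>E. l (\<phi> c) * of_bool ({c} \<subseteq> A)"
  have l_add: "l (x + y) = l x + l y" if "x \<in> vecs W" "y \<in> vecs W" for x y
    using linear that by (auto simp: linear_on_def)
  have l0: "l 0 = 0" using l_add[OF W(1) W(1)] by (metis add.right_neutral add_left_cancel)
  have mem_l_sum: "(\<Sum>c\<in>A. \<phi> c) \<in> vecs W \<and> l (\<Sum>c\<in>A. \<phi> c) = (\<Sum>c\<in>A. l (\<phi> c))" if "finite A" "A \<subseteq> E" for A
    using that by induction (auto simp: l0 W l_add \<phi>)
  have "l (\<Sum>c\<in>A. \<phi> c) = ?F A" if A: "A \<subseteq> E" for A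
  proof -
    have "?F A = (\<Sum>c\<in>A. l (\<phi> c))"
      using E A by (intro sum.mono_neutral_cong_right) auto
    then show ?thesis using mem_l_sum[of A] A E finite_subset by metis
  qed
  then show ?case
    using linear by (intro exI[of _ ?F] conjI set_poly_sum set_poly_monomial) auto
next
  case (add d f h)
  then obtain F H where "set_poly d F" "\<forall>A\<subseteq>E. f (\<Sum>c\<in>A. \<phi> c) = F A" "set_poly d H" "\<forall>A\<subseteq>E. h (\<Sum>c\<in>A. \<phi> c) = H A"
    by blast
  then show ?case by (intro exI[of _ "\<lambda>A. F A + H A"]) (auto intro: set_poly_add)
next
  case (mult d f e h)
  then obtain F H where "set_poly d F" "\<forall>A\<subseteq>E. f (\<Sum>c\<in>A. \<phi> c) = F A" "set_poly e H" "\<forall>A\<subseteq>E. h (\<Sum>c\<in>A. \<phi> c) = H A"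
    by blast
  then show ?case by (intro exI[of _ "\<lambda>A. F A * H A"]) (auto intro: set_poly_mult)
qed

lemma poly_fun_translation_invariant:
  fixes W :: "('g, 'k::field, 'w::ab_group_add) rep" and E :: "'k set"
  assumes p: "prime p" "CHAR('k) = p"
    and E: "finite E" "card E = p ^ n" "0 \<in> E" "\<And>x y. x \<in> E \<Longrightarrow> y \<in> E \<Longrightarrow> x + y \<in> E"
    and W: "0 \<in> vecs W" "\<And>x y. x \<in> vecs W \<Longrightarrow> y \<in> vecs W \<Longrightarrow> x + y \<in> vecs W"
    and \<phi>: "\<And>c. c \<in> E \<Longrightarrow> \<phi> c \<in> vecs W"
    and f: "poly_fun W d f" "d < p ^ n"
    and inv: "\<And>A e. A \<subseteq> E \<Longrightarrow> e \<in> E \<Longrightarrow> f (\<Sum>c\<in>A. \<phi> (e + c)) = f (\<Sum>c\<in>A. \<phi> c)"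
  shows "f (\<Sum>c\<in>E. \<phi> c) = f 0"
proof -
  define h where "h w = f w + - f 0" for w
  define g where "g A = (- 1) ^ card A * h (\<Sum>c\<in>A. \<phi> c)" for A
  have "poly_fun W d h"
    unfolding h_def using f(1) by (intro poly_fun.add poly_fun.const)
  then obtain F where F: "set_poly d F" "\<And>A. A \<subseteq> E \<Longrightarrow> h (\<Sum>c\<in>A. \<phi> c) = F A"
    using poly_fun_set_poly[of W d h E \<phi>] E(1) W \<phi> by blast
  have "(\<Sum>A\<in>Pow E. g A) = (\<Sum>A\<in>Pow E. (- 1) ^ card A * F A)"
    by (intro sum.cong) (auto simp: g_def F)
  also have "\<dots> = 0"
    using F(1) E f(2) by (intro set_poly_alternating_sum) auto
  finally have "(\<Sum>A\<in>Pow E. g A) = 0" .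
  moreover have "(\<Sum>A\<in>Pow E. g A) = g {} + g E"
  proof (rule sum_Pow_translation_invariant[OF p E(1-3)])
    fix A e assume "A \<subseteq> E" "e \<in> E"
    then show "g ((+) e ` A) = g A"
      using inv[of A e] by (simp add: g_def h_def card_image sum.reindex)
  qed (use E(4) in auto)
  ultimately show ?thesis by (simp add: g_def h_def)
qed

section \<open>Bases of powers of linear forms\<close>

lemma exists_dual_vector:
  fixes e1 e2 :: "'k::field^2"
  assumes "e1 $ 1 * e2 $ 2 \<noteq> e1 $ 2 * e2 $ 1"
  obtains M :: "'k^2^2" where "\<And>c. M *v (e2 + c *s e1) = (c - x) *s axis 1 1"
proof -
  define D where "D = e1 $ 1 * e2 $ 2 - e1 $ 2 * e2 $ 1"
  define u v where "u = (e2 $ 2 + x * e1 $ 2) / D" and "v = (- e2 $ 1 - x * e1 $ 1) / D"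
  have D: "D \<noteq> 0" using assms by (simp add: D_def)
  have 1: "u * e1 $ 1 + v * e1 $ 2 = 1" "u * e2 $ 1 + v * e2 $ 2 = - x"
    using D by (simp_all add: u_def v_def field_simps) (simp_all add: D_def algebra_simps)
  define M :: "'k^2^2" where "M = (\<chi> i j. if i = 1 then (if j = 1 then u else v) else 0)"
  have "M *v (e2 + c *s e1) = (c - x) *s axis 1 1" for c
  proof -
    have "u * (e2 $ 1 + c * e1 $ 1) + v * (e2 $ 2 + c * e1 $ 2) =
        (u * e2 $ 1 + v * e2 $ 2) + c * (u * e1 $ 1 + v * e1 $ 2)"
      by (simp add: algebra_simps)
    also have "\<dots> = c - x" unfolding 1 by simp
    finally have "u * (e2 $ 1 + c * e1 $ 1) + v * (e2 $ 2 + c * e1 $ 2) = c - x" .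
    then show ?thesis
      by (simp add: vec_eq_iff forall_2 matrix_vector_mult_def sum_2 M_def axis_def)
  qed
  then show ?thesis using that by blast
qed

lemma line_powers_independent:
  fixes e1 e2 :: "'k::field^2"
  assumes p: "prime p" "CHAR('k) = p" and inf: "infinite (UNIV :: 'k set)"
    and E: "finite E" "card E = p ^ n"
    and e: "e1 $ 1 * e2 $ 2 \<noteq> e1 $ 2 * e2 $ 1"
    and zero: "(\<Sum>c\<in>E. sym_scale (a c) (sym_of (e2 + c *s e1) ^ (p ^ n - 1))) = 0" and c: "c \<in> E"
  shows "a c = 0"
proof (rule shifted_powers_independent[OF p inf E _ c])
  fix x
  define r where "r = p ^ n - 1"
  obtain M :: "'k^2^2" where M: "\<And>c. M *v (e2 + c *s e1) = (c - x) *s axis 1 1"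
    using exists_dual_vector[OF e] by blast
  have pow: "sym_of (d *s axis 1 1) ^ r = Poly_Mapping.single (Poly_Mapping.single 1 r) (d ^ r)" for d :: 'k
  proof -
    have "sym_of (d *s axis 1 1) ^ r = sym_scale (d ^ r) (sym_of (axis 1 1) ^ r)"
      by (induction r) (simp_all add: sym_of_scale sym_scale_mult_left sym_scale_mult_right)
    then show ?thesis
      by (simp only: sym_of_axis single_single_power sym_scale_single mult_1_right)
  qed
  have "0 = sym_map ((*v) M) (\<Sum>c\<in>E. sym_scale (a c) (sym_of (e2 + c *s e1) ^ r))"
    using zero by (simp add: r_def)
  also have "\<dots> = (\<Sum>c\<in>E. Poly_Mapping.single (Poly_Mapping.single 1 r) (a c * (c - x) ^ r))"
    by (simp add: sym_map_sum sym_map_scale sym_map_sym_of_power M pow sym_scale_single)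
  finally have "Poly_Mapping.lookup (\<Sum>c\<in>E. Poly_Mapping.single (Poly_Mapping.single 1 r) (a c * (c - x) ^ r))
      (Poly_Mapping.single (1::2) r) = 0" by simp
  then show "(\<Sum>c\<in>E. a c * (c - x) ^ (p ^ n - 1)) = 0"
    by (simp add: lookup_sum r_def)
qed

definition line_basis :: "'k::field^2 \<Rightarrow> 'k^2 \<Rightarrow> nat \<Rightarrow> 'k \<Rightarrow> ('k, 2) sym" where
  "line_basis e1 e2 r c = sym_of (e2 + c *s e1) ^ r"

lemma line_basis_independent_span:
  fixes e1 e2 :: "'k::field^2"
  assumes p: "prime p" "CHAR('k) = p" and inf: "infinite (UNIV :: 'k set)"
    and E: "finite E" "card E = p ^ n"
    and e: "e1 $ 1 * e2 $ 2 \<noteq> e1 $ 2 * e2 $ 1"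
  defines "b \<equiv> line_basis e1 e2 (p ^ n - 1)"
  shows "inj_on b E" "sym.independent (b ` E)" "b ` E \<subseteq> homogeneous (p ^ n - 1)"
    "homogeneous (p ^ n - 1) \<subseteq> sym.span (b ` E)"
proof -
  have indep: "a c = 0" if "(\<Sum>c\<in>E. sym_scale (a c) (b c)) = 0" "c \<in> E" for a c
    using line_powers_independent[OF p inf E e, of a c] that by (simp add: b_def line_basis_def)
  show inj: "inj_on b E"
  proof (rule inj_onI, rule ccontr)
    fix c d assume cd: "c \<in> E" "d \<in> E" "b c = b d" "c \<noteq> d"
    define a :: "'k \<Rightarrow> 'k" where "a x = (if x = c then 1 else if x = d then - 1 else 0)" for x
    have "(\<Sum>x\<in>E. sym_scale (a x) (b x)) = (\<Sum>x\<in>{c, d}. sym_scale (a x) (b x))"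
      using E(1) cd by (intro sum.mono_neutral_right) (auto simp: a_def)
    also have "\<dots> = 0" using cd by (simp add: a_def)
    finally have "a c = 0" using indep cd by blast
    then show False by (simp add: a_def)
  qed
  show ind: "sym.independent (b ` E)"
  proof (rule sym.independent_if_scalars_zero)
    fix f x assume "(\<Sum>x\<in>b ` E. sym_scale (f x) x) = 0" "x \<in> b ` E"
    then show "f x = 0" using indep[of "f \<circ> b"] inj by (auto simp: sum.reindex)
  qed (use E in auto)
  show hom: "b ` E \<subseteq> homogeneous (p ^ n - 1)"
    using homogeneous_power[OF homogeneous_sym_of, of _ "p ^ n - 1"] by (auto simp: b_def line_basis_def)
  have "card (b ` E) = Suc (p ^ n - 1)"
    using E inj p(1) by (simp add: card_image prime_gt_0_nat)
  then show "homogeneous (p ^ n - 1) \<subseteq> sym.span (b ` E)"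
    using homogeneous_subset_span[OF ind hom] by blast
qed

section \<open>Endomorphisms of binary forms\<close>

abbreviation End_rep :: "('k::field^2^2) set \<Rightarrow> nat \<Rightarrow> ('k^2^2, 'k, ('k, 2) sym \<Rightarrow> ('k, 2) sym) rep" where
  "End_rep G r \<equiv> Hom_rep (GL\<lparr>carrier := G\<rparr>) (Sym_rep r natural_rep) (Sym_rep r natural_rep)"

lemma Sym_natural_rep_simps [simp]:
  "vecs (Sym_rep r natural_rep) = homogeneous r"
  "scl (Sym_rep r natural_rep) = sym_scale"
  "act (Sym_rep r natural_rep) g = sym_map ((*v) g)"
  by (simp_all add: Sym_rep_def natural_rep_def homogeneous_def)

lemma vecs_End_rep:
  "T \<in> vecs (End_rep G r) \<longleftrightarrow>
     (\<forall>x\<in>homogeneous r. \<forall>y\<in>homogeneous r. T (x + y) = T x + T y) \<and>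
     (\<forall>c. \<forall>x\<in>homogeneous r. T (sym_scale c x) = sym_scale c (T x)) \<and>
     (\<forall>x\<in>homogeneous r. T x \<in> homogeneous r) \<and> (\<forall>x. x \<notin> homogeneous r \<longrightarrow> T x = 0)"
  by (auto simp: Hom_rep_def linear_on_def)

lemma scl_End_rep: "scl (End_rep G r) c T = (\<lambda>x. sym_scale c (T x))"
  by (simp add: Hom_rep_def)

lemma act_End_rep:
  "act (End_rep G r) g T =
     (\<lambda>x. if x \<in> homogeneous r
        then sym_map ((*v) g) (T (sym_map ((*v) (inv\<^bsub>GL\<lparr>carrier := G\<rparr>\<^esub> g)) x)) else 0)"
  by (simp add: Hom_rep_def cong: if_cong)

lemma zero_in_End_rep: "0 \<in> vecs (End_rep G r)"
  by (simp add: vecs_End_rep)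

lemma add_in_End_rep: "S \<in> vecs (End_rep G r) \<Longrightarrow> T \<in> vecs (End_rep G r) \<Longrightarrow> S + T \<in> vecs (End_rep G r)"
  by (simp add: vecs_End_rep sym.scale_right_distrib homogeneous_add)

lemma sum_in_End_rep:
  "(\<And>i. i \<in> I \<Longrightarrow> T i \<in> vecs (End_rep G r)) \<Longrightarrow> (\<Sum>i\<in>I. T i) \<in> vecs (End_rep G r)"
  by (induction I rule: infinite_finite_induct) (auto intro: zero_in_End_rep add_in_End_rep)

lemma group_GL: "group (GL :: ('k::field^'n^'n) monoid)"
proof (rule groupI)
  fix A :: "'k^'n^'n" assume "A \<in> carrier GL"
  then obtain B where B: "A ** B = mat 1" "B ** A = mat 1"
    by (auto simp: GL_def invertible_def)
  then have "invertible B" by (auto simp: invertible_def)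
  then show "\<exists>B\<in>carrier GL. B \<otimes>\<^bsub>GL\<^esub> A = \<one>\<^bsub>GL\<^esub>"
    using B by (auto simp: GL_def)
qed (auto simp: GL_def invertible_mult matrix_mul_assoc invertible_def[of "mat 1"])

lemma inv_GL_subgroup:
  fixes G :: "('k::field^'n^'n) set"
  assumes "subgroup G GL" "g \<in> G"
  shows "inv\<^bsub>GL\<lparr>carrier := G\<rparr>\<^esub> g \<in> G"
    "inv\<^bsub>GL\<lparr>carrier := G\<rparr>\<^esub> g ** g = mat 1"
    "g ** inv\<^bsub>GL\<lparr>carrier := G\<rparr>\<^esub> g = mat 1"
proof -
  interpret group "GL\<lparr>carrier := G\<rparr>"
    using subgroup.subgroup_is_group[OF assms(1) group_GL] .
  show "inv\<^bsub>GL\<lparr>carrier := G\<rparr>\<^esub> g \<in> G" using inv_closed[of g] assms by simp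
  show "inv\<^bsub>GL\<lparr>carrier := G\<rparr>\<^esub> g ** g = mat 1"
    "g ** inv\<^bsub>GL\<lparr>carrier := G\<rparr>\<^esub> g = mat 1"
    using l_inv[of g] r_inv[of g] assms by (simp_all add: GL_def)
qed

section \<open>The determinant as an invariant\<close>

definition binary_mat :: "nat \<Rightarrow> (('k::field, 2) sym \<Rightarrow> ('k, 2) sym) \<Rightarrow> 'k Matrix.mat" where
  "binary_mat r T = Matrix.mat (Suc r) (Suc r)
     (\<lambda>(i, j). Poly_Mapping.lookup (T (Poly_Mapping.single (binary_monomial r j) 1)) (binary_monomial r i))"

lemma binary_mat_carrier: "binary_mat r T \<in> carrier_mat (Suc r) (Suc r)"
  by (simp add: binary_mat_def)

lemma binary_mat_cong:
  "(\<And>x. x \<in> homogeneous r \<Longrightarrow> S x = T x) \<Longrightarrow> binary_mat r S = binary_mat r T"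
  unfolding binary_mat_def by (rule eq_matI) (auto simp: homogeneous_binary_monomial)

lemma binary_mat_id: "binary_mat r (\<lambda>x. x) = 1\<^sub>m (Suc r)"
  unfolding binary_mat_def
  by (rule eq_matI) (auto simp: lookup_single when_def inj_eq[OF inj_binary_monomial])

lemma binary_mat_comp:
  assumes T: "\<And>x y. x \<in> homogeneous r \<Longrightarrow> y \<in> homogeneous r \<Longrightarrow> T (x + y) = T x + T y"
    "\<And>c x. x \<in> homogeneous r \<Longrightarrow> T (sym_scale c x) = sym_scale c (T x)"
    and S: "\<And>x. x \<in> homogeneous r \<Longrightarrow> S x \<in> homogeneous r"
  shows "binary_mat r (\<lambda>x. T (S x)) = binary_mat r T * binary_mat r S"
proof (rule eq_matI)
  fix i j assume ij: "i < dim_row (binary_mat r T * binary_mat r S)" "j < dim_col (binary_mat r T * binary_mat r S)"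
  then have ij: "i < Suc r" "j < Suc r" by (simp_all add: binary_mat_def)
  let ?m = "\<lambda>l. Poly_Mapping.single (binary_monomial r l) (1::'a)"
  define s where "s = S (?m j)"
  have s: "s \<in> homogeneous r"
    unfolding s_def using ij by (intro S homogeneous_binary_monomial) auto
  have T0: "T 0 = 0" using T(2)[of 0 0] by simp
  have T_sum: "T (\<Sum>l\<in>L. sym_scale (a l) (?m l)) = (\<Sum>l\<in>L. sym_scale (a l) (T (?m l)))" if "L \<subseteq> {..r}" for L a
  proof -
    have "finite L" using that finite_subset by blast
    then show ?thesis using that
      by induction (auto simp: T0 T homogeneous_sum homogeneous_scale homogeneous_binary_monomial subset_iff)
  qed
  have "s = (\<Sum>l\<le>r. sym_scale (Poly_Mapping.lookup s (binary_monomial r l)) (?m l))"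
    using homogeneous_eq_sum_binary_monomials[OF s] by (simp add: sym_scale_single)
  then have "T s = T (\<Sum>l\<le>r. sym_scale (Poly_Mapping.lookup s (binary_monomial r l)) (?m l))"
    by (rule arg_cong)
  then have "T s = (\<Sum>l\<le>r. sym_scale (Poly_Mapping.lookup s (binary_monomial r l)) (T (?m l)))"
    unfolding T_sum[OF order.refl] .
  then show "binary_mat r (\<lambda>x. T (S x)) $$ (i, j) = (binary_mat r T * binary_mat r S) $$ (i, j)"
    using ij by (simp add: binary_mat_def scalar_prod_def lookup_sum lookup_sym_scale s_def
        atLeast0LessThan lessThan_Suc_atMost mult.commute)
qed (simp_all add: binary_mat_def)

lemma poly_fun_sum:
  "(\<And>i. i \<in> I \<Longrightarrow> poly_fun W d (f i)) \<Longrightarrow> poly_fun W d (\<lambda>w. \<Sum>i\<in>I. f i w)"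
  by (induction I rule: infinite_finite_induct) (auto intro: poly_fun.intros)

lemma poly_fun_prod:
  "(\<And>i. i \<in> I \<Longrightarrow> poly_fun W d (f i)) \<Longrightarrow> poly_fun W (card I * d) (\<lambda>w. \<Prod>i\<in>I. f i w)"
  by (induction I rule: infinite_finite_induct) (auto intro: poly_fun.intros)

lemma det_coordinate_ring: "(\<lambda>T. Determinant.det (binary_mat r T)) \<in> coordinate_ring (End_rep G r)"
proof -
  have "linear_on (End_rep G r) (*) (\<lambda>T. binary_mat r T $$ (i, j))" if "i < Suc r" "j < Suc r" for i j
    using that by (simp add: linear_on_def binary_mat_def scl_End_rep lookup_add lookup_sym_scale)
  then have entry: "poly_fun (End_rep G r) 1 (\<lambda>T. binary_mat r T $$ (i, j))" if "i < Suc r" "j < Suc r" for i j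
    using that by (intro poly_fun.linear) auto
  have "poly_fun (End_rep G r) (0 + card {0..<Suc r} * 1)
      (\<lambda>T. signof \<pi> * (\<Prod>i\<in>{0..<Suc r}. binary_mat r T $$ (i, \<pi> i)))" if "\<pi> permutes {0..<Suc r}" for \<pi>
    using that permutes_in_image[OF that]
    by (intro poly_fun.mult poly_fun.const poly_fun_prod entry) (metis atLeastLessThan_iff)+
  then have "poly_fun (End_rep G r) (0 + card {0..<Suc r} * 1) (\<lambda>T. Determinant.det (binary_mat r T))"
    unfolding det_def'[OF binary_mat_carrier] by (intro poly_fun_sum) auto
  then show ?thesis by (auto simp: coordinate_ring_def)
qed

lemma det_invariant:
  assumes G: "subgroup G GL"
  shows "(\<lambda>T. Determinant.det (binary_mat r T)) \<in> invariants (GL\<lparr>carrier := G\<rparr>) (End_rep G r)"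
proof -
  have main: "Determinant.det (binary_mat r (act (End_rep G r) g T)) = Determinant.det (binary_mat r T)"
    if g: "g \<in> G" and T: "T \<in> vecs (End_rep G r)" for g T
  proof -
    define h where "h = inv\<^bsub>GL\<lparr>carrier := G\<rparr>\<^esub> g"
    let ?g = "sym_map ((*v) g)" and ?h = "sym_map ((*v) h)"
    have gh: "g ** h = mat 1" using inv_GL_subgroup[OF G g] by (simp add: h_def)
    have T': "\<And>x y. x \<in> homogeneous r \<Longrightarrow> y \<in> homogeneous r \<Longrightarrow> T (x + y) = T x + T y"
      "\<And>c x. x \<in> homogeneous r \<Longrightarrow> T (sym_scale c x) = sym_scale c (T x)"
      "\<And>x. x \<in> homogeneous r \<Longrightarrow> T x \<in> homogeneous r"
      using T by (auto simp: vecs_End_rep)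
    have "binary_mat r (act (End_rep G r) g T) = binary_mat r (\<lambda>x. ?g (T (?h x)))"
      by (rule binary_mat_cong) (simp add: act_End_rep h_def)
    also have "\<dots> = binary_mat r ?g * binary_mat r (\<lambda>x. T (?h x))"
      by (rule binary_mat_comp) (simp_all add: sym_map_add sym_map_scale T' homogeneous_sym_map)
    also have "binary_mat r (\<lambda>x. T (?h x)) = binary_mat r T * binary_mat r ?h"
      by (rule binary_mat_comp) (simp_all add: T' homogeneous_sym_map)
    finally have 1: "binary_mat r (act (End_rep G r) g T) = binary_mat r ?g * (binary_mat r T * binary_mat r ?h)" .
    have "binary_mat r ?g * binary_mat r ?h = binary_mat r (\<lambda>x. ?g (?h x))"
      by (rule binary_mat_comp[symmetric]) (simp_all add: sym_map_add sym_map_scale homogeneous_sym_map)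
    also have "\<dots> = 1\<^sub>m (Suc r)"
      by (simp add: sym_map_comp gh sym_map_mat_1 binary_mat_id)
    finally have "Determinant.det (binary_mat r ?g) * Determinant.det (binary_mat r ?h) = 1"
      by (metis det_mult binary_mat_carrier det_one)
    moreover have "Determinant.det (binary_mat r ?g * (binary_mat r T * binary_mat r ?h)) =
        Determinant.det (binary_mat r ?g) * (Determinant.det (binary_mat r T) * Determinant.det (binary_mat r ?h))"
      by (metis det_mult binary_mat_carrier mult_carrier_mat)
    moreover have "\<dots> = Determinant.det (binary_mat r ?g) * Determinant.det (binary_mat r ?h) * Determinant.det (binary_mat r T)"
      by (simp only: mult_ac)
    ultimately show ?thesis unfolding 1 by simp
  qed
  then show ?thesis
    using det_coordinate_ring inv_GL_subgroup(1)[OF G] by (auto simp: invariants_def)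
qed

definition restricted_id :: "nat \<Rightarrow> ('k::field, 2) sym \<Rightarrow> ('k, 2) sym" where
  "restricted_id r x = (if x \<in> homogeneous r then x else 0)"

lemma restricted_id_fixed:
  fixes G :: "('k::field^2^2) set"
  assumes G: "subgroup G GL"
  shows "restricted_id r \<in> fixed_points (GL\<lparr>carrier := G\<rparr>) (End_rep G r)"
proof -
  have "act (End_rep G r) g (restricted_id r) x = restricted_id r x" if "g \<in> G" for g and x :: "('k, 2) sym"
    using inv_GL_subgroup(3)[OF G that]
    by (simp add: act_End_rep restricted_id_def homogeneous_sym_map sym_map_comp sym_map_mat_1)
  moreover have "restricted_id r \<in> vecs (End_rep G r)"
    by (simp add: vecs_End_rep restricted_id_def homogeneous_add homogeneous_scale)
  ultimately show ?thesis by (simp add: fixed_points_def fun_eq_iff)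
qed

lemma restricted_id_not_nullcone:
  assumes G: "subgroup G GL"
  shows "restricted_id r \<notin> nullcone (GL\<lparr>carrier := G\<rparr>) (End_rep G r)"
proof -
  have "binary_mat r (restricted_id r :: ('a, 2) sym \<Rightarrow> _) = 1\<^sub>m (Suc r)"
    unfolding binary_mat_id[symmetric] by (rule binary_mat_cong) (simp add: restricted_id_def)
  then have "Determinant.det (binary_mat r (restricted_id r :: ('a, 2) sym \<Rightarrow> _)) \<noteq> 0"
    by (simp add: det_one)
  moreover have "binary_mat r (0 :: ('a, 2) sym \<Rightarrow> _) = 0\<^sub>m (Suc r) (Suc r)"
    unfolding binary_mat_def by (rule eq_matI) auto
  then have "Determinant.det (binary_mat r (0 :: ('a, 2) sym \<Rightarrow> _)) = 0"
    by simp
  ultimately show ?thesis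
    using det_invariant[OF G, of r] unfolding nullcone_def positive_part_def by auto
qed

section \<open>The projections onto basis lines\<close>

definition line_projection :: "'k::field^2 \<Rightarrow> 'k^2 \<Rightarrow> nat \<Rightarrow> 'k set \<Rightarrow> 'k \<Rightarrow> ('k, 2) sym \<Rightarrow> ('k, 2) sym" where
  "line_projection e1 e2 r E c x = (if x \<in> homogeneous r
     then sym_scale (sym.representation (line_basis e1 e2 r ` E) x (line_basis e1 e2 r c)) (line_basis e1 e2 r c)
     else 0)"

lemma sum_fun_apply: "(\<Sum>i\<in>I. f i) x = (\<Sum>i\<in>I. f i x)"
  by (induction I rule: infinite_finite_induct) auto

context
  fixes e1 e2 :: "'k::field^2" and p n r :: nat and E :: "'k set"
  assumes p: "prime p" "CHAR('k) = p" and inf: "infinite (UNIV :: 'k set)"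
    and E: "finite E" "card E = p ^ n"
    and e: "e1 $ 1 * e2 $ 2 \<noteq> e1 $ 2 * e2 $ 1"
    and r: "r = p ^ n - 1"
begin

private abbreviation "b \<equiv> line_basis e1 e2 r"
private abbreviation "\<phi> \<equiv> line_projection e1 e2 r E"

private lemmas basis = line_basis_independent_span[OF p inf E e, folded r]

lemma line_projection_End: "c \<in> E \<Longrightarrow> \<phi> c \<in> vecs (End_rep G r)"
proof -
  assume c: "c \<in> E"
  have span: "x \<in> sym.span (b ` E)" if "x \<in> homogeneous r" for x
    using basis(4) that by blast
  have "b c \<in> homogeneous r" using basis(3) c by blast
  then show ?thesis
    by (simp add: vecs_End_rep line_projection_def homogeneous_add homogeneous_scale
        sym.representation_add[OF basis(2)] sym.representation_scale[OF basis(2)]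
        sym.scale_left_distrib span)
qed

lemma sum_line_projection: "(\<Sum>c\<in>E. \<phi> c) = restricted_id r"
proof
  fix x :: "('k, 2) sym"
  show "(\<Sum>c\<in>E. \<phi> c) x = restricted_id r x"
  proof (cases "x \<in> homogeneous r")
    case True
    then have "(\<Sum>y\<in>b ` E. sym_scale (sym.representation (b ` E) x y) y) = x"
      using basis E by (intro sym.sum_representation_eq) auto
    then show ?thesis
      using True basis(1) by (simp add: sum_fun_apply line_projection_def restricted_id_def sum.reindex)
  qed (simp add: sum_fun_apply line_projection_def restricted_id_def)
qed

lemma act_line_projection:
  assumes G: "subgroup G GL" and g: "g \<in> G"
    and g_b: "\<And>c. sym_map ((*v) g) (b c) = b (t + c)"
    and Et: "\<And>c. c \<in> E \<Longrightarrow> t + c \<in> E" and c: "c \<in> E"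
  shows "act (End_rep G r) g (\<phi> c) = \<phi> (t + c)"
proof
  fix x :: "('k, 2) sym"
  show "act (End_rep G r) g (\<phi> c) x = \<phi> (t + c) x"
  proof (cases "x \<in> homogeneous r")
    case True
    define h where "h = inv\<^bsub>GL\<lparr>carrier := G\<rparr>\<^esub> g"
    define y where "y = sym_map ((*v) h) x"
    let ?rep = "sym.representation (b ` E)"
    have y: "y \<in> homogeneous r" unfolding y_def using True by (rule homogeneous_sym_map)
    have x: "x = sym_map ((*v) g) y"
      using inv_GL_subgroup[OF G g] by (simp add: y_def h_def sym_map_comp sym_map_mat_1)
    have "y = (\<Sum>z\<in>b ` E. sym_scale (?rep y z) z)"
      using y basis E by (intro sym.sum_representation_eq[symmetric]) auto
    also have "\<dots> = (\<Sum>c\<in>E. sym_scale (?rep y (b c)) (b c))"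
      using basis(1) by (simp add: sum.reindex)
    finally have "x = (\<Sum>c\<in>E. sym_scale (?rep y (b c)) (b (t + c)))"
      using x by (metis (no_types, lifting) g_b sum.cong sym_map_scale sym_map_sum)
    then have "?rep x (b (t + c)) = (\<Sum>c'\<in>E. ?rep y (b c') * ?rep (b (t + c')) (b (t + c)))"
      using basis Et
      by (simp add: sym.representation_sum sym.representation_scale sym.span_base sym.span_scale)
    also have "\<dots> = (\<Sum>c'\<in>E. if c' = c then ?rep y (b c) else 0)"
    proof (intro sum.cong refl)
      fix c' assume c': "c' \<in> E"
      have "b (t + c') = b (t + c) \<longleftrightarrow> c' = c"
        using basis(1) Et c c' by (auto simp: inj_on_eq_iff)
      then show "?rep y (b c') * ?rep (b (t + c')) (b (t + c)) = (if c' = c then ?rep y (b c) else 0)"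
        using sym.representation_basis[OF basis(2), of "b (t + c')"] Et[OF c'] by auto
    qed
    also have "\<dots> = ?rep y (b c)" using c E by simp
    finally show ?thesis
      using True y by (simp add: act_End_rep line_projection_def y_def h_def sym_map_scale g_b)
  qed (simp add: act_End_rep line_projection_def)
qed

end

theorem proposition3p6:
  fixes G :: "('k::alg_closed_field^2^2) set" and p n :: nat
  assumes "CHAR('k) = p" and "p > 0"
    and "subgroup G GL" and "closed_in_GL G"
    and "\<exists>U. subgroup U GL \<and> U \<subseteq> G \<and> infinite U \<and> (\<forall>u \<in> U. unipotent u)"
  shows "delta (GL\<lparr>carrier := G\<rparr>)
           (Hom_rep (GL\<lparr>carrier := G\<rparr>)
              (Sym_rep (p ^ n - 1) natural_rep) (Sym_rep (p ^ n - 1) natural_rep))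
         \<ge> enat (p ^ n)"
proof -
  define r where "r = p ^ n - 1"
  note G = \<open>subgroup G GL\<close>
  have p: "prime p" "CHAR('k) = p"
    using assms(1,2) prime_CHAR_semidom by auto
  obtain U where U: "subgroup U GL" "U \<subseteq> G" "infinite U" "\<And>u. u \<in> U \<Longrightarrow> unipotent u"
    using assms(5) by blast
  obtain N e where N: "N ** N = 0" "(N *v e) $ 1 * e $ 2 \<noteq> (N *v e) $ 2 * e $ 1"
    "U \<subseteq> range (shear N)"
    using unipotent_subgroup_2x2[OF U(1,3,4)] by blast
  define T where "T = {t. shear N t \<in> U}"
  have infT: "infinite T"
  proof
    assume "finite T"
    moreover have "U = shear N ` T" using N(3) by (auto simp: T_def)
    ultimately show False using U(3) by simp
  qed
  have T0: "0 \<in> T"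
    using subgroup.one_closed[OF U(1)] by (simp add: T_def shear_0 GL_def)
  have T_add: "s + t \<in> T" if "s \<in> T" "t \<in> T" for s t
    using subgroup.m_closed[OF U(1), of "shear N s" "shear N t"] that shear_add[OF N(1), of s t]
    by (simp add: T_def GL_def)
  obtain E where E: "E \<subseteq> T" "finite E" "card E = p ^ n" "0 \<in> E" "\<And>x y. x \<in> E \<Longrightarrow> y \<in> E \<Longrightarrow> x + y \<in> E"
    using exists_finite_subgroup[OF p infT T0 T_add, of n] by blast
  have inf: "infinite (UNIV :: 'k set)"
    using infT by (meson finite_subset subset_UNIV)
  let ?\<phi> = "line_projection (N *v e) e r E"
  note basis_facts = p inf E(2,3) N(2) r_def
  have \<phi>: "?\<phi> c \<in> vecs (End_rep G r)" if "c \<in> E" for c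
    by (rule line_projection_End[OF basis_facts that])
  have "f (restricted_id r) = f 0" if f: "f \<in> invariants_le (GL\<lparr>carrier := G\<rparr>) (End_rep G r) d" "d < p ^ n" for f d
  proof -
    have inv_f: "f (act (End_rep G r) g w) = f w" if "g \<in> G" "w \<in> vecs (End_rep G r)" for g w
    proof -
      interpret group "GL\<lparr>carrier := G\<rparr>" using subgroup.subgroup_is_group[OF G group_GL] .
      show ?thesis
      proof -
        have "\<forall>g\<in>G. \<forall>w\<in>vecs (End_rep G r). f (act (End_rep G r) (inv\<^bsub>GL\<lparr>carrier := G\<rparr>\<^esub> g) w) = f w"
          using f(1) by (simp add: invariants_le_def invariants_def)
        moreover have "inv\<^bsub>GL\<lparr>carrier := G\<rparr>\<^esub> g \<in> G" "inv\<^bsub>GL\<lparr>carrier := G\<rparr>\<^esub> (inv\<^bsub>GL\<lparr>carrier := G\<rparr>\<^esub> g) = g"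
          using that(1) inv_closed[of g] inv_inv[of g] by simp_all
        ultimately show ?thesis using that(2) by metis
      qed
    qed
    have "f (\<Sum>c\<in>E. ?\<phi> c) = f 0"
    proof (rule poly_fun_translation_invariant[where f = f and \<phi> = ?\<phi> and W = "End_rep G r", OF p E(2-4)])
      show "\<And>x y. x \<in> E \<Longrightarrow> y \<in> E \<Longrightarrow> x + y \<in> E" by (rule E(5))
      show "0 \<in> vecs (End_rep G r)" by (rule zero_in_End_rep)
      show "\<And>S T. S \<in> vecs (End_rep G r) \<Longrightarrow> T \<in> vecs (End_rep G r) \<Longrightarrow> S + T \<in> vecs (End_rep G r)"
        by (rule add_in_End_rep)
      show "\<And>c. c \<in> E \<Longrightarrow> ?\<phi> c \<in> vecs (End_rep G r)" by (rule \<phi>)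
      show "d < p ^ n" by (rule f(2))
      show "poly_fun (End_rep G r) d f" using f(1) by (simp add: invariants_le_def)
      fix A t assume A: "A \<subseteq> E" and t: "t \<in> E"
      have g: "shear N t \<in> G" using t E(1) U(2) by (auto simp: T_def)
      have "sym_map ((*v) (shear N t)) (line_basis (N *v e) e r c) = line_basis (N *v e) e r (t + c)" for c
      proof -
        have "N *v (N *v e) = 0" using N(1) by (simp add: matrix_vector_mul_assoc)
        then have "shear N t *v (e + c *s (N *v e)) = e + (t + c) *s (N *v e)"
          by (simp add: shear_vec vec.add vec.scale vector_sadd_rdistrib add_ac)
        then show ?thesis by (simp add: line_basis_def sym_map_sym_of_power)
      qed
      then have "act (End_rep G r) (shear N t) (?\<phi> c) = ?\<phi> (t + c)" if "c \<in> E" for c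
        using act_line_projection[OF basis_facts G g] E(5)[OF t] that by blast
      then have "(\<Sum>c\<in>A. ?\<phi> (t + c)) = (\<Sum>c\<in>A. act (End_rep G r) (shear N t) (?\<phi> c))"
        using A by (intro sum.cong) auto
      also have "\<dots> = act (End_rep G r) (shear N t) (\<Sum>c\<in>A. ?\<phi> c)"
        by (auto simp: fun_eq_iff sum_fun_apply act_End_rep sym_map_sum)
      finally show "f (\<Sum>c\<in>A. ?\<phi> (t + c)) = f (\<Sum>c\<in>A. ?\<phi> c)"
        using inv_f[OF g sum_in_End_rep[of A ?\<phi>]] A \<phi> by auto
    qed
    then show ?thesis using sum_line_projection[OF basis_facts] by simp
  qed
  note const = this
  have "p ^ n \<le> d" if delta: "delta_set (GL\<lparr>carrier := G\<rparr>) (End_rep G r)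
      (invariants_le (GL\<lparr>carrier := G\<rparr>) (End_rep G r) d)" for d
  proof (rule ccontr)
    assume "\<not> p ^ n \<le> d"
    have "restricted_id r \<in> fixed_points (GL\<lparr>carrier := G\<rparr>) (End_rep G r) - nullcone (GL\<lparr>carrier := G\<rparr>) (End_rep G r)"
      using restricted_id_fixed[OF G] restricted_id_not_nullcone[OF G] by (rule DiffI)
    then obtain f where "f \<in> positive_part (invariants_le (GL\<lparr>carrier := G\<rparr>) (End_rep G r) d)" "f (restricted_id r) \<noteq> 0"
      using delta unfolding delta_set_def by blast
    then show False
      using const[of f d] \<open>\<not> p ^ n \<le> d\<close> by (simp add: positive_part_def)
  qed
  then show ?thesis
    unfolding delta_def r_def[symmetric] by (intro Inf_greatest) auto
qed

end
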